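(* Let $G=(V,E)$ be an Erdős–Rényi random graph on $n$ vertices in which every edge is present independently with probability $p=2\log n/n$. With high probability over the randomness of $G$, every distance labeling scheme for $G$ that recovers all pairwise distances exactly has total length at least $\Omega(n^{3/2}/\log^4 n)$. In particular, with high probability every 2-hop cover of $G$ stores at least $\Omega(n^{3/2}/\log^4 n)$ landmarks in total.
   Context: A distance labeling scheme assigns to each vertex $v$ a binary string $\mathcal L(v)$ such that a decoding rule fixed in advance (not depending on $G$) computes $\mathrm{dist}_G(x,y)$ from $\mathcal L(x)$ and $\mathcal L(y)$ alone, for all $x,y\in V$; its total length is $\sum_{v}|\mathcal L(v)|$. A 2-hop cover is a landmark labeling $\{L(v)\}$ (each landmark $z\in L(v)$ stored with $\mathrm{dist}(v,z)$) such that $\min_{z\in L(x)\cap L(y)}(\mathrm{dist}(x,z)+\mathrm{dist}(z,y))=\mathrm{dist}(x,y)$ for all pairs $x,y$ in the same connected component; its number of landmarks is $\sum_v|L(v)|$. "With high probability" means with probability tending to $1$ as $n\to\infty$. *)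

theory Defs
  imports "HOL-Probability.Probability" "HOL-Library.Extended_Nat"
begin

definition vertex_pairs :: "nat \<Rightarrow> (nat \<times> nat) set" where
  "vertex_pairs n = {(i, j). i < j \<and> j < n}"

text \<open>Erdos-Renyi random graph G(n,p): each potential edge present independently with prob. p.
  A sample is an indicator function on pairs (False outside vertex_pairs n).\<close>
definition gnp :: "nat \<Rightarrow> real \<Rightarrow> (nat \<times> nat \<Rightarrow> bool) pmf" where
  "gnp n p = Pi_pmf (vertex_pairs n) False (\<lambda>_. bernoulli_pmf p)"

definition adj :: "nat \<Rightarrow> (nat \<times> nat \<Rightarrow> bool) \<Rightarrow> nat \<Rightarrow> nat \<Rightarrow> bool" where
  "adj n g u v = (u < n \<and> v < n \<and> u \<noteq> v \<and> g (min u v, max u v))"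

fun has_walk :: "(nat \<Rightarrow> nat \<Rightarrow> bool) \<Rightarrow> nat \<Rightarrow> nat \<Rightarrow> nat \<Rightarrow> bool" where
  "has_walk E 0 u v = (u = v)"
| "has_walk E (Suc k) u v = (\<exists>w. E u w \<and> has_walk E k w v)"

definition gdist :: "(nat \<Rightarrow> nat \<Rightarrow> bool) \<Rightarrow> nat \<Rightarrow> nat \<Rightarrow> enat" where
  "gdist E u v = (if \<exists>k. has_walk E k u v then enat (LEAST k. has_walk E k u v) else \<infinity>)"

text \<open>Distance labeling: a decoder dec (fixed independently of the graph) and labels lab
  such that dec (lab x) (lab y) = dist(x,y) for all vertices x,y.\<close>
definition is_distance_labeling ::
  "nat \<Rightarrow> (nat \<Rightarrow> nat \<Rightarrow> bool) \<Rightarrow> (bool list \<Rightarrow> bool list \<Rightarrow> enat) \<Rightarrow> (nat \<Rightarrow> bool list) \<Rightarrow> bool" where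
  "is_distance_labeling n E dec lab =
     (\<forall>x<n. \<forall>y<n. dec (lab x) (lab y) = gdist E x y)"

definition labeling_length :: "nat \<Rightarrow> (nat \<Rightarrow> bool list) \<Rightarrow> nat" where
  "labeling_length n lab = (\<Sum>v<n. length (lab v))"

text \<open>2-hop cover: landmark sets L v of vertices (distances to landmarks are the true ones).\<close>
definition is_2hop_cover :: "nat \<Rightarrow> (nat \<Rightarrow> nat \<Rightarrow> bool) \<Rightarrow> (nat \<Rightarrow> nat set) \<Rightarrow> bool" where
  "is_2hop_cover n E L =
     ((\<forall>v<n. L v \<subseteq> {..<n}) \<and>
      (\<forall>x<n. \<forall>y<n. gdist E x y \<noteq> \<infinity> \<longrightarrow>
          (INF z\<in>L x \<inter> L y. gdist E x z + gdist E z y) = gdist E x y))"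

definition num_landmarks :: "nat \<Rightarrow> (nat \<Rightarrow> nat set) \<Rightarrow> nat" where
  "num_landmarks n L = (\<Sum>v<n. card (L v))"

end

theory Submission
  imports Defs "HOL-Real_Asymp.Real_Asymp"
begin

text \<open>Fix a block of about \<open>\<surd>n \<cdot> ln\<^sup>-\<^sup>3\<^sup>/\<^sup>8 n\<close> vertices and explore, one after the other, balls of
  radius \<open>k\<close> around them, each avoiding the vertices already found, where \<open>k\<close> is maximal
  with \<open>(2 ln n)\<^sup>k \<le> \<surd>n \<cdot> ln\<^sup>-\<^sup>3\<^sup>/\<^sup>4 n\<close>. The balls are so small that with high probability most
  of them keep an outermost layer of size of order \<open>(2 ln n)\<^sup>k\<close> and most pairs of centres
  have distance more than \<open>2k + 1\<close>. The pairs between two outermost layers have not been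
  inspected by the exploration, and a single edge among them would bring the two centres within
  distance \<open>2k + 1\<close>. Hence fixed labels on the block, which prescribe the far pairs, are correct
  only with probability \<open>exp (- p (2 ln n)\<^sup>2\<^sup>k s\<^sup>2 / const)\<close>, where \<open>s\<close> is the size of the block.
  This beats the number of short labels of a block, and by averaging a short
  labeling is short on at least half of the blocks. The argument yields the bound
  \<open>n\<^sup>3\<^sup>/\<^sup>2 / ln\<^sup>3 n\<close> for labelings; the additional logarithm pays for writing a landmark and its
  distance with \<open>O(ln n)\<close> bits.\<close>

section \<open>Sequential breadth-first search\<close>

text \<open>Labels depend on the graph, so a union bound over label lists must beat a factor
  exponential in the number of label bits. The exploration cannot supply this: its failures are only
  shown to be small like a power of \<open>ln n\<close>. The randomness is therefore split. Bad
  explorations are discarded once, by an event that mentions no labels; the union bound is charged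
  solely to the uninspected pairs between outermost layers, where the absence of all edges is
  exponentially unlikely. Two constraints fix the sizes, with \<open>D = (2 ln n)^k\<close> and
  block size \<open>s\<close>. The balls of one block may use up only a fraction
  \<open>o(1 / ln n)\<close> of the vertices, because each of about \<open>ln n / ln ln n\<close>
  growth steps may lose that fraction again; hence \<open>s * D\<close> is slightly below
  \<open>n / ln n\<close>. And \<open>p * D^2\<close> has to vanish, so that two centres are
  typically too far apart for a crossing edge to be admissible. With \<open>D\<close> close to
  \<open>\<surd>n\<close> up to logarithms, \<open>s\<close> is close to \<open>\<surd>n\<close>
  too, which is why the vertex set is treated in blocks.\<close>

type_synonym config = "nat \<times> nat \<Rightarrow> bool"

text \<open>\<open>W\<close> holds the processed and the discovered vertices of earlier balls; a
  vertex is processed once the pairs at it may have been inspected. If \<open>x\<close> was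
  discovered before, the initial layer is empty and so are all later ones, so a swallowed centre
  needs no special treatment.\<close>

fun bfs :: "nat \<Rightarrow> config \<Rightarrow> nat set \<times> nat set \<Rightarrow> nat \<Rightarrow> nat \<Rightarrow> nat set \<times> nat set \<times> nat set" where
  "bfs n g W x 0 = (fst W, insert x (snd W), {x} - snd W)"
| "bfs n g W x (Suc j) =
    (let (T, U, A) = bfs n g W x j; B = {v. v < n \<and> v \<notin> U \<and> (\<exists>u\<in>A. adj n g u v)}
     in (T \<union> A, U \<union> B, B))"

abbreviation processed :: "'a \<times> 'b \<times> 'c \<Rightarrow> 'a" where "processed st \<equiv> fst st"
abbreviation discovered :: "'a \<times> 'b \<times> 'c \<Rightarrow> 'b" where "discovered st \<equiv> fst (snd st)"
abbreviation layer :: "'a \<times> 'b \<times> 'c \<Rightarrow> 'c" where "layer st \<equiv> snd (snd st)"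

text \<open>The last layer is passed on as discovered but not as processed: later balls cannot enter
  it, and pairs between such layers stay uninspected.\<close>

fun sweep :: "nat \<Rightarrow> config \<Rightarrow> (nat \<Rightarrow> nat) \<Rightarrow> nat \<Rightarrow> nat \<Rightarrow> nat set \<times> nat set" where
  "sweep n g x k 0 = ({}, {})"
| "sweep n g x k (Suc i) =
    (let st = bfs n g (sweep n g x k i) (x i) k in (processed st, discovered st))"

definition stage :: "nat \<Rightarrow> config \<Rightarrow> (nat \<Rightarrow> nat) \<Rightarrow> nat \<Rightarrow> nat \<Rightarrow> nat \<Rightarrow> nat set \<times> nat set \<times> nat set" where
  "stage n g x k i j = bfs n g (sweep n g x k i) (x i) j"

lemma bfs_Suc_simps:
  "processed (bfs n g W x (Suc j)) = processed (bfs n g W x j) \<union> layer (bfs n g W x j)"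
  "discovered (bfs n g W x (Suc j)) = discovered (bfs n g W x j) \<union> layer (bfs n g W x (Suc j))"
  "layer (bfs n g W x (Suc j)) =
    {v. v < n \<and> v \<notin> discovered (bfs n g W x j) \<and> (\<exists>u\<in>layer (bfs n g W x j). adj n g u v)}"
  by (auto simp: Let_def split: prod.splits)

declare bfs.simps(2) [simp del]
declare bfs_Suc_simps(1,2) [simp]

lemma bfs_discovered_mono: "j \<le> j' \<Longrightarrow> discovered (bfs n g W x j) \<subseteq> discovered (bfs n g W x j')"
  by (induction j' rule: dec_induct) auto

lemma bfs_invariant:
  assumes "fst W \<subseteq> snd W"
  shows "processed (bfs n g W x j) \<subseteq> discovered (bfs n g W x j)
    \<and> layer (bfs n g W x j) \<subseteq> discovered (bfs n g W x j)
    \<and> layer (bfs n g W x j) \<inter> processed (bfs n g W x j) = {}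
    \<and> layer (bfs n g W x j) \<inter> snd W = {}
    \<and> snd W \<subseteq> discovered (bfs n g W x j)
    \<and> fst W \<subseteq> processed (bfs n g W x j)
    \<and> processed (bfs n g W x j) \<inter> snd W \<subseteq> fst W"
proof (induction j)
  case 0
  show ?case using assms by auto
next
  case (Suc j)
  have "layer (bfs n g W x (Suc j)) \<inter> discovered (bfs n g W x j) = {}"
    by (auto simp: bfs_Suc_simps(3))
  with Suc show ?case by auto
qed

lemma bfs_bounded:
  assumes "snd W \<subseteq> {..<n}" "x < n"
  shows "discovered (bfs n g W x j) \<subseteq> {..<n} \<and> layer (bfs n g W x j) \<subseteq> {..<n}"
  using assms by (induction j) (auto simp: bfs_Suc_simps(3))

lemma bfs_discovered_eq: "discovered (bfs n g W x j) = snd W \<union> (\<Union>t\<le>j. layer (bfs n g W x t))"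
  by (induction j) (auto simp: atMost_Suc)

lemma sweep_simps [simp]:
  "fst (sweep n g x k (Suc i)) = processed (stage n g x k i k)"
  "snd (sweep n g x k (Suc i)) = discovered (stage n g x k i k)"
  by (simp_all add: stage_def Let_def)

declare sweep.simps(2) [simp del]

lemma sweep_invariant: "fst (sweep n g x k i) \<subseteq> snd (sweep n g x k i)"
proof (induction i)
  case (Suc i)
  show ?case using bfs_invariant[OF Suc] by (simp add: stage_def)
qed auto

lemma stage_invariant:
  "processed (stage n g x k i j) \<subseteq> discovered (stage n g x k i j)"
  "layer (stage n g x k i j) \<subseteq> discovered (stage n g x k i j)"
  "layer (stage n g x k i j) \<inter> processed (stage n g x k i j) = {}"
  "layer (stage n g x k i j) \<inter> snd (sweep n g x k i) = {}"
  "snd (sweep n g x k i) \<subseteq> discovered (stage n g x k i j)"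
  "fst (sweep n g x k i) \<subseteq> processed (stage n g x k i j)"
  "processed (stage n g x k i j) \<inter> snd (sweep n g x k i) \<subseteq> fst (sweep n g x k i)"
  using bfs_invariant[OF sweep_invariant[of n g x k i], of n g "x i" j] unfolding stage_def by auto

lemma sweep_discovered_eq:
  "snd (sweep n g x k i) = (\<Union>i'<i. \<Union>t\<le>k. layer (stage n g x k i' t))"
proof (induction i)
  case (Suc i)
  show ?case unfolding sweep_simps lessThan_Suc
    using Suc bfs_discovered_eq[of n g "sweep n g x k i" "x i" k] by (auto simp: stage_def)
qed auto

lemma sweep_bounded:
  assumes "\<And>i'. i' < i \<Longrightarrow> x i' < n"
  shows "snd (sweep n g x k i) \<subseteq> {..<n}"
  using assms
proof (induction i)
  case (Suc i)
  then have "snd (sweep n g x k i) \<subseteq> {..<n}" "x i < n" by auto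
  from bfs_bounded[OF this] show ?case by (simp add: stage_def)
qed auto

lemma stage_bounded:
  assumes "\<And>i'. i' \<le> i \<Longrightarrow> x i' < n"
  shows "discovered (stage n g x k i j) \<subseteq> {..<n}" "layer (stage n g x k i j) \<subseteq> {..<n}"
  using bfs_bounded[OF sweep_bounded[of i x n g k], of "x i"] assms by (auto simp: stage_def)

lemma sweep_mono:
  assumes "i \<le> i'"
  shows "fst (sweep n g x k i) \<subseteq> fst (sweep n g x k i')" "snd (sweep n g x k i) \<subseteq> snd (sweep n g x k i')"
  using assms
proof (induction i' rule: dec_induct)
  case (step m)
  { case 1 then show ?case using step(3) stage_invariant(6)[of n g x k m k] by simp }
  { case 2 then show ?case using step(4) stage_invariant(5)[of n g x k m k] by simp }
qed auto

lemma stage_subset_sweep: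
  assumes "i < i'" "j \<le> k"
  shows "discovered (stage n g x k i j) \<subseteq> snd (sweep n g x k i')"
proof -
  have "discovered (stage n g x k i j) \<subseteq> snd (sweep n g x k (Suc i))"
    using bfs_discovered_mono[OF assms(2)] by (simp add: stage_def)
  also have "\<dots> \<subseteq> snd (sweep n g x k i')" using assms by (intro sweep_mono) auto
  finally show ?thesis .
qed

text \<open>Later balls only process vertices that were undiscovered before, so the outermost layers
  stay unprocessed for ever.\<close>
lemma sweep_processed_old:
  assumes "i \<le> i'"
  shows "fst (sweep n g x k i') \<inter> snd (sweep n g x k i) \<subseteq> fst (sweep n g x k i)"
  using assms
proof (induction i' rule: dec_induct)
  case (step m)
  have "snd (sweep n g x k i) \<subseteq> snd (sweep n g x k m)" using step by (intro sweep_mono)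
  then show ?case using step(3) stage_invariant(7)[of n g x k m k] unfolding sweep_simps by blast
qed auto

lemma outer_layer_unprocessed:
  assumes "i < s"
  shows "layer (stage n g x k i k) \<inter> fst (sweep n g x k s) = {}"
proof -
  have "fst (sweep n g x k s) \<inter> snd (sweep n g x k (Suc i)) \<subseteq> fst (sweep n g x k (Suc i))"
    using assms by (intro sweep_processed_old) auto
  then show ?thesis
    using stage_invariant(2,3)[where n = n and g = g and x = x and k = k and i = i and j = k]
    unfolding sweep_simps by blast
qed

lemma outer_layers_disjoint:
  assumes "i < i'"
  shows "layer (stage n g x k i k) \<inter> layer (stage n g x k i' k) = {}"
proof -
  have "layer (stage n g x k i k) \<subseteq> snd (sweep n g x k i')"
    using stage_invariant(2)[of n g x k i k] stage_subset_sweep[OF assms order.refl, of n g x k] by blast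
  then show ?thesis using stage_invariant(4)[of n g x k i' k] by blast
qed

text \<open>A step reads only pairs at the layer that it is about to process. So the run depends on
  nothing but the pairs at processed vertices, the stopping-time property that makes all other pairs
  fresh.\<close>

lemma bfs_determined:
  assumes "\<And>u v. u \<in> processed (bfs n g W x j) \<Longrightarrow> adj n g u v = adj n h u v"
  shows "bfs n h W x j = bfs n g W x j"
  using assms
proof (induction j)
  case (Suc j)
  then have "bfs n h W x j = bfs n g W x j" by auto
  moreover from this Suc.prems have "layer (bfs n h W x (Suc j)) = layer (bfs n g W x (Suc j))"
    by (auto simp: bfs_Suc_simps(3))
  ultimately show ?case by (simp add: prod_eq_iff)
qed auto

lemma sweep_determined:
  assumes "\<And>u v. u \<in> fst (sweep n g x k i) \<Longrightarrow> adj n g u v = adj n h u v"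
  shows "sweep n h x k i = sweep n g x k i"
  using assms
proof (induction i)
  case (Suc i)
  have "fst (sweep n g x k i) \<subseteq> fst (sweep n g x k (Suc i))" by (intro sweep_mono) auto
  with Suc have "sweep n h x k i = sweep n g x k i" by blast
  moreover have "bfs n h (sweep n g x k i) (x i) k = bfs n g (sweep n g x k i) (x i) k"
    using Suc.prems by (intro bfs_determined) (auto simp: stage_def)
  ultimately show ?case by (simp add: sweep.simps(2))
qed auto

lemma stage_determined:
  assumes "\<And>u v. u \<in> processed (stage n g x k i j) \<Longrightarrow> adj n g u v = adj n h u v"
  shows "stage n h x k i j = stage n g x k i j"
proof -
  have "sweep n h x k i = sweep n g x k i"
    using assms stage_invariant(6)[of n g x k i j] by (intro sweep_determined) blast
  then show ?thesis using bfs_determined[of n g "sweep n g x k i" "x i" j h] assms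
    by (simp add: stage_def)
qed

lemma stage_determined_by_sweep:
  assumes "\<And>u v. u \<in> fst (sweep n g x k s) \<Longrightarrow> adj n g u v = adj n h u v" "i < s"
  shows "stage n h x k i k = stage n g x k i k"
proof -
  have "processed (stage n g x k i k) \<subseteq> fst (sweep n g x k s)"
    using sweep_mono(1)[of "Suc i" s n g x k] assms(2) by auto
  then show ?thesis using assms(1) by (intro stage_determined) auto
qed

section \<open>Walks, distances and layers\<close>

lemma adj_sym: "adj n g u v \<longleftrightarrow> adj n g v u"
  by (auto simp: adj_def min.commute max.commute)

lemma has_walk_append: "has_walk E a u v \<Longrightarrow> has_walk E b v w \<Longrightarrow> has_walk E (a + b) u w"
  by (induction a arbitrary: u) auto

lemma has_walk_one: "E u v \<Longrightarrow> has_walk E 1 u v"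
  by simp

lemma has_walk_adj_rev: "has_walk (adj n g) a u v \<Longrightarrow> has_walk (adj n g) a v u"
proof (induction a arbitrary: u)
  case (Suc a)
  then obtain w where "adj n g u w" "has_walk (adj n g) a w v" by auto
  with Suc.IH has_walk_one[of "adj n g" w u] have "has_walk (adj n g) (a + 1) v u"
    by (intro has_walk_append) (auto simp: adj_sym)
  then show ?case by simp
qed auto

lemma gdist_le_iff: "gdist E u v \<le> enat m \<longleftrightarrow> (\<exists>j\<le>m. has_walk E j u v)"
proof
  assume "gdist E u v \<le> enat m"
  then show "\<exists>j\<le>m. has_walk E j u v"
    by (auto simp: gdist_def split: if_splits intro: LeastI)
next
  assume "\<exists>j\<le>m. has_walk E j u v"
  then obtain j where "j \<le> m" "has_walk E j u v" by auto
  then have "(LEAST k. has_walk E k u v) \<le> m" by (meson Least_le order.trans)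
  with \<open>has_walk E j u v\<close> show "gdist E u v \<le> enat m" by (auto simp: gdist_def)
qed

lemma has_walk_layer: "u \<in> layer (bfs n g W x j) \<Longrightarrow> has_walk (adj n g) j x u"
proof (induction j arbitrary: u)
  case (Suc j)
  then obtain w where "w \<in> layer (bfs n g W x j)" "adj n g w u" by (auto simp: bfs_Suc_simps(3))
  with Suc.IH have "has_walk (adj n g) (j + 1) x u" by (intro has_walk_append has_walk_one)
  then show ?case by simp
qed auto

lemma gdist_le_if_outer_edge:
  assumes "u \<in> layer (stage n g x k i k)" "v \<in> layer (stage n g x k j k)" "adj n g u v"
  shows "gdist (adj n g) (x i) (x j) \<le> enat (2 * k + 1)"
proof -
  have walks: "has_walk (adj n g) k (x i) u" "has_walk (adj n g) k (x j) v"
    using assms by (auto simp: stage_def intro: has_walk_layer)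
  have "has_walk (adj n g) (k + 1 + k) (x i) (x j)"
    by (rule has_walk_append[OF has_walk_append[OF walks(1) has_walk_one[of "adj n g", OF assms(3)]]
          has_walk_adj_rev[OF walks(2)]])
  moreover have "k + 1 + k \<le> 2 * k + 1" by simp
  ultimately show ?thesis unfolding gdist_le_iff by blast
qed

lemma has_walk_Suc_last: "has_walk E (Suc k) u v \<Longrightarrow> \<exists>w. has_walk E k u w \<and> E w v"
  by (induction k arbitrary: u) (auto, blast)

text \<open>The start state must be empty: only then do the layers exhaust the ball, whereas
  otherwise a short walk may run through vertices that the exploration avoids.\<close>

lemma has_walk_discovered:
  assumes "has_walk (adj n g) j x v"
  shows "v \<in> discovered (bfs n g ({}, {}) x j)"
  using assms
proof (induction j arbitrary: v)
  case (Suc j)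
  from has_walk_Suc_last[OF Suc.prems] obtain w where w: "has_walk (adj n g) j x w" "adj n g w v" by auto
  from Suc.IH[OF w(1)] obtain t where t: "t \<le> j" "w \<in> layer (bfs n g ({}, {}) x t)"
    unfolding bfs_discovered_eq by auto
  have "v < n" using w by (auto simp: adj_def)
  with w t have "v \<in> discovered (bfs n g ({}, {}) x t) \<or> v \<in> layer (bfs n g ({}, {}) x (Suc t))"
    by (auto simp: bfs_Suc_simps(3))
  then have "v \<in> discovered (bfs n g ({}, {}) x (Suc t))" by auto
  with bfs_discovered_mono[of "Suc t" "Suc j"] t show ?case by blast
qed auto

section \<open>Resampling unexplored pairs\<close>

text \<open>\<open>Q g\<close> is determined by the values of \<open>g\<close> outside it. Hence,
  for a fixed target \<open>f\<close>, the mixture equals \<open>f\<close> exactly if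
  \<open>g\<close> agrees with \<open>f\<close> off \<open>Q f\<close> and \<open>h\<close> agrees
  with \<open>f\<close> on \<open>Q f\<close>. The two conditions are independent, and their product
  probabilities multiply to the mass of \<open>f\<close>.\<close>

lemma Pi_pmf_resample:
  fixes Q :: "('a \<Rightarrow> 'b) \<Rightarrow> 'a set"
  assumes fin: "finite I"
    and det: "\<And>g g'. (\<And>e. e \<notin> Q g \<Longrightarrow> g e = g' e) \<Longrightarrow> Q g' = Q g"
  shows "bind_pmf (Pi_pmf I d D) (\<lambda>g. map_pmf (\<lambda>h e. if e \<in> Q g then h e else g e) (Pi_pmf I d D))
    = Pi_pmf I d D"
proof (rule pmf_eqI)
  fix f :: "'a \<Rightarrow> 'b"
  define P where "P = Pi_pmf I d D"
  define A where "A = {g. \<forall>e. e \<notin> Q f \<longrightarrow> g e = f e}"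
  define B where "B = {h. \<forall>e\<in>Q f. h e = f e}"
  have mix: "(\<lambda>e. if e \<in> Q g then h e else g e) = f \<longleftrightarrow> g \<in> A \<and> h \<in> B" for g h
  proof
    assume eq: "(\<lambda>e. if e \<in> Q g then h e else g e) = f"
    have "Q f = Q g" by (rule det) (simp add: eq[symmetric])
    with eq show "g \<in> A \<and> h \<in> B" by (auto simp: A_def B_def)
  next
    assume gh: "g \<in> A \<and> h \<in> B"
    have "Q g = Q f" by (rule det) (use gh in \<open>auto simp: A_def\<close>)
    with gh show "(\<lambda>e. if e \<in> Q g then h e else g e) = f" by (auto simp: A_def B_def)
  qed
  have "pmf (bind_pmf P (\<lambda>g. map_pmf (\<lambda>h e. if e \<in> Q g then h e else g e) P)) f
      = measure_pmf.expectation P (\<lambda>g. measure_pmf.prob P {h. g \<in> A \<and> h \<in> B})"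
    by (simp add: pmf_bind pmf_map vimage_def mix)
  also have "\<dots> = measure_pmf.expectation P (\<lambda>g. indicator A g * measure_pmf.prob P B)"
    by (intro Bochner_Integration.integral_cong) (auto simp: indicator_def)
  also have "\<dots> = measure_pmf.prob P A * measure_pmf.prob P B" by simp
  also have "\<dots> = pmf P f"
  proof (cases "\<forall>e. e \<notin> I \<longrightarrow> f e = d")
    case True
    have supp: "g e = d" if "g \<in> set_pmf P" "e \<notin> I" for g e
      using set_Pi_pmf_subset[OF fin, of d D] that by (auto simp: P_def)
    have "measure_pmf.prob P A = measure_pmf.prob P (A \<inter> set_pmf P)"
      by (simp add: measure_Int_set_pmf)
    also have "A \<inter> set_pmf P = Pi I (\<lambda>e. if e \<in> Q f then UNIV else {f e}) \<inter> set_pmf P"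
      using True supp by (auto simp: A_def Pi_def split: if_splits)
    also have "measure_pmf.prob P \<dots> = measure_pmf.prob P (Pi I (\<lambda>e. if e \<in> Q f then UNIV else {f e}))"
      by (simp add: measure_Int_set_pmf)
    also have "\<dots> = (\<Prod>e\<in>I. if e \<in> Q f then 1 else pmf (D e) (f e))"
      unfolding P_def by (subst measure_Pi_pmf_Pi[OF fin]) (auto intro!: prod.cong simp: measure_pmf_single)
    finally have PA: "measure_pmf.prob P A = \<dots>" .
    have "measure_pmf.prob P B = measure_pmf.prob P (B \<inter> set_pmf P)"
      by (simp add: measure_Int_set_pmf)
    also have "B \<inter> set_pmf P = Pi I (\<lambda>e. if e \<in> Q f then {f e} else UNIV) \<inter> set_pmf P"
      using True supp by (auto simp: B_def Pi_def split: if_splits)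
    also have "measure_pmf.prob P \<dots> = measure_pmf.prob P (Pi I (\<lambda>e. if e \<in> Q f then {f e} else UNIV))"
      by (simp add: measure_Int_set_pmf)
    also have "\<dots> = (\<Prod>e\<in>I. if e \<in> Q f then pmf (D e) (f e) else 1)"
      unfolding P_def by (subst measure_Pi_pmf_Pi[OF fin]) (auto intro!: prod.cong simp: measure_pmf_single)
    finally have PB: "measure_pmf.prob P B = \<dots>" .
    have "measure_pmf.prob P A * measure_pmf.prob P B = (\<Prod>e\<in>I. pmf (D e) (f e))"
      unfolding PA PB prod.distrib[symmetric] by (intro prod.cong) auto
    also have "\<dots> = pmf P f" unfolding P_def using True by (subst pmf_Pi'[OF fin]) auto
    finally show ?thesis .
  next
    case False
    \<comment> \<open>Off \<open>I\<close> a sample has the value \<open>d\<close>, so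
      \<open>f\<close> has mass 0. The factor that prescribes the value at \<open>e\<close>
      vanishes: \<open>B\<close> if \<open>e\<close> is resampled, \<open>A\<close>
      otherwise.\<close>
    then obtain e where e: "e \<notin> I" "f e \<noteq> d" by auto
    have out: "measure_pmf.prob P {g. g e = f e} = 0"
      using set_Pi_pmf_subset[OF fin, of d D] e by (subst measure_pmf_zero_iff) (auto simp: P_def)
    have "measure_pmf.prob P A = 0 \<or> measure_pmf.prob P B = 0"
    proof (cases "e \<in> Q f")
      case True
      then have "B \<subseteq> {g. g e = f e}" by (auto simp: B_def)
      then have "measure_pmf.prob P B \<le> measure_pmf.prob P {g. g e = f e}"
        by (intro measure_pmf.finite_measure_mono) auto
      then show ?thesis using out by (simp add: measure_le_0_iff)
    next
      case False
      then have "A \<subseteq> {g. g e = f e}" by (auto simp: A_def)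
      then have "measure_pmf.prob P A \<le> measure_pmf.prob P {g. g e = f e}"
        by (intro measure_pmf.finite_measure_mono) auto
      then show ?thesis using out by (simp add: measure_le_0_iff)
    qed
    moreover have "pmf P f = 0" unfolding P_def using e by (subst pmf_Pi[OF fin]) auto
    ultimately show ?thesis by auto
  qed
  finally show "pmf (bind_pmf (Pi_pmf I d D)
      (\<lambda>g. map_pmf (\<lambda>h e. if e \<in> Q g then h e else g e) (Pi_pmf I d D))) f = pmf (Pi_pmf I d D) f"
    unfolding P_def .
qed

lemma measure_bind_pmf_eq_expectation:
  "measure_pmf.prob (bind_pmf M N) A = measure_pmf.expectation M (\<lambda>x. measure_pmf.prob (N x) A)"
proof -
  have int: "integrable (measure_pmf M) (\<lambda>x. measure_pmf.prob (N x) A)"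
    by (intro measure_pmf.integrable_const_bound[of _ 1]) auto
  have "ennreal (measure_pmf.prob (bind_pmf M N) A) = (\<integral>\<^sup>+x. ennreal (measure_pmf.prob (N x) A) \<partial>M)"
    by (simp flip: measure_pmf.emeasure_eq_measure)
  also have "\<dots> = ennreal (measure_pmf.expectation M (\<lambda>x. measure_pmf.prob (N x) A))"
    by (intro nn_integral_eq_integral int) auto
  finally show ?thesis by (simp add: integral_nonneg_AE)
qed

section \<open>Fresh edges in the random graph\<close>

definition mix :: "nat set \<Rightarrow> config \<Rightarrow> config \<Rightarrow> config" where
  "mix T g h e = (if fst e \<in> T \<or> snd e \<in> T then g e else h e)"

lemma adj_mix: "adj n (mix T g h) u v = (if u \<in> T \<or> v \<in> T then adj n g u v else adj n h u v)"
  by (auto simp: adj_def mix_def min_def max_def)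

lemma finite_vertex_pairs: "finite (vertex_pairs n)"
  by (rule finite_subset[of _ "{..<n} \<times> {..<n}"]) (auto simp: vertex_pairs_def)

lemma edge_in_vertex_pairs: "u < n \<Longrightarrow> v < n \<Longrightarrow> u \<noteq> v \<Longrightarrow> (min u v, max u v) \<in> vertex_pairs n"
  by (auto simp: vertex_pairs_def min_def max_def)

lemma finite_set_pmf_gnp: "finite (set_pmf (gnp n p))"
proof (rule finite_subset)
  show "set_pmf (gnp n p) \<subseteq> PiE_dflt (vertex_pairs n) False (\<lambda>_. UNIV)"
    unfolding gnp_def using set_Pi_pmf_subset'[OF finite_vertex_pairs, of n False "\<lambda>_. bernoulli_pmf p"]
    by (auto simp: PiE_dflt_def)
  show "finite (PiE_dflt (vertex_pairs n) False (\<lambda>_. UNIV :: bool set))"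
    by (intro finite_PiE_dflt finite_vertex_pairs) auto
qed

lemma integrable_gnp [simp]:
  fixes f :: "config \<Rightarrow> real"
  shows "integrable (measure_pmf (gnp n p)) f"
  by (rule integrable_measure_pmf_finite[OF finite_set_pmf_gnp])

text \<open>The principle of deferred decisions: \<open>T\<close> is the set of processed vertices, so pairs that do
  not touch it have not been inspected.\<close>
lemma gnp_resample:
  assumes det: "\<And>g h. (\<And>u v. u \<in> T g \<Longrightarrow> adj n g u v = adj n h u v) \<Longrightarrow> T h = T g"
  shows "measure_pmf.prob (gnp n p) E
    = measure_pmf.expectation (gnp n p) (\<lambda>g. measure_pmf.prob (gnp n p) {h. mix (T g) g h \<in> E})"
proof -
  define Q where "Q g = {e. fst e \<notin> T g \<and> snd e \<notin> T g}" for g :: config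
  have "Q g' = Q g" if "\<And>e. e \<notin> Q g \<Longrightarrow> g e = g' e" for g g'
  proof -
    have "T g' = T g"
    proof (rule det)
      fix u v assume "u \<in> T g"
      then have "g (min u v, max u v) = g' (min u v, max u v)"
        by (intro that) (auto simp: Q_def min_def max_def)
      then show "adj n g u v = adj n g' u v" by (simp add: adj_def)
    qed
    then show ?thesis by (simp add: Q_def)
  qed
  from Pi_pmf_resample[of "vertex_pairs n" Q, OF finite_vertex_pairs this]
  have "gnp n p = bind_pmf (gnp n p) (\<lambda>g. map_pmf (\<lambda>h e. if e \<in> Q g then h e else g e) (gnp n p))"
    unfolding gnp_def by simp
  also have "(\<lambda>g. map_pmf (\<lambda>h e. if e \<in> Q g then h e else g e) (gnp n p))
      = (\<lambda>g. map_pmf (mix (T g) g) (gnp n p))"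
    by (intro ext arg_cong2[of _ _ _ _ map_pmf]) (auto simp: Q_def mix_def)
  finally have "measure_pmf.prob (gnp n p) E
      = measure_pmf.prob (bind_pmf (gnp n p) (\<lambda>g. map_pmf (mix (T g) g) (gnp n p))) E" by simp
  also have "\<dots> = measure_pmf.expectation (gnp n p) (\<lambda>g. measure_pmf.prob (gnp n p) {h. mix (T g) g h \<in> E})"
    unfolding measure_bind_pmf_eq_expectation by (simp add: vimage_def)
  finally show ?thesis .
qed

text \<open>\<open>c g\<close> bounds the conditional probability of \<open>E\<close> given the part
  of \<open>g\<close> explored so far.\<close>

lemma gnp_resample_le_expectation:
  assumes "\<And>g h. (\<And>u v. u \<in> T g \<Longrightarrow> adj n g u v = adj n h u v) \<Longrightarrow> T h = T g"
    and "\<And>g. g \<in> set_pmf (gnp n p) \<Longrightarrow> measure_pmf.prob (gnp n p) {h. mix (T g) g h \<in> E} \<le> c g"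
  shows "measure_pmf.prob (gnp n p) E \<le> measure_pmf.expectation (gnp n p) c"
proof -
  have "measure_pmf.prob (gnp n p) E
      = measure_pmf.expectation (gnp n p) (\<lambda>g. measure_pmf.prob (gnp n p) {h. mix (T g) g h \<in> E})"
    using assms(1) by (rule gnp_resample)
  also have "\<dots> \<le> measure_pmf.expectation (gnp n p) c"
    by (intro integral_mono_AE) (auto simp: AE_measure_pmf_iff assms(2))
  finally show ?thesis .
qed

lemma gnp_resample_le:
  assumes "\<And>g h. (\<And>u v. u \<in> T g \<Longrightarrow> adj n g u v = adj n h u v) \<Longrightarrow> T h = T g"
    and "\<And>g. measure_pmf.prob (gnp n p) {h. mix (T g) g h \<in> E} \<le> c"
  shows "measure_pmf.prob (gnp n p) E \<le> c"
proof -
  have "measure_pmf.prob (gnp n p) E \<le> measure_pmf.expectation (gnp n p) (\<lambda>_. c)"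
  proof (rule gnp_resample_le_expectation[where T = T])
    show "T h = T g" if "\<And>u v. u \<in> T g \<Longrightarrow> adj n g u v = adj n h u v" for g h
      using that by (rule assms(1))
  qed (rule assms(2))
  then show ?thesis by simp
qed

lemma gnp_prob_no_edges:
  assumes "J \<subseteq> vertex_pairs n" "0 \<le> p" "p \<le> 1"
  shows "measure_pmf.prob (gnp n p) {h. \<forall>e\<in>J. \<not> h e} = (1 - p) ^ card J"
proof -
  have "{h. \<forall>e\<in>J. \<not> h e} = Pi (vertex_pairs n) (\<lambda>e. if e \<in> J then {False} else UNIV)"
    using assms(1) by (auto simp: Pi_def split: if_splits)
  also have "measure_pmf.prob (gnp n p) \<dots> = (\<Prod>e\<in>vertex_pairs n. if e \<in> J then 1 - p else 1)"
    unfolding gnp_def using assms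
    by (subst measure_Pi_pmf_Pi[OF finite_vertex_pairs]) (auto intro!: prod.cong simp: measure_pmf_single)
  also have "\<dots> = (\<Prod>e\<in>J. 1 - p)"
    using assms(1) by (intro prod.mono_neutral_cong_right finite_vertex_pairs) auto
  finally show ?thesis by simp
qed

lemma gnp_prob_edge:
  assumes "e \<in> vertex_pairs n" "0 \<le> p" "p \<le> 1"
  shows "measure_pmf.prob (gnp n p) {h. h e} = p"
proof -
  have "measure_pmf.prob (gnp n p) {h. h e} = 1 - measure_pmf.prob (gnp n p) (UNIV - {h. h e})"
    using measure_pmf.prob_compl[of "{h. h e}" "gnp n p"] by simp
  also have "UNIV - {h. h e} = {h. \<forall>e\<in>{e}. \<not> h e}" by auto
  finally show ?thesis using gnp_prob_no_edges[of "{e}" n p] assms by simp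
qed

lemma expectation_card:
  assumes "finite V"
  shows "measure_pmf.expectation (gnp n p) (\<lambda>g. real (card {v\<in>V. R g v}))
    = (\<Sum>v\<in>V. measure_pmf.prob (gnp n p) {g. R g v})"
proof -
  have "real (card {v\<in>V. R g v}) = (\<Sum>v\<in>V. indicator {g. R g v} g)" for g
    using assms by (simp add: indicator_def sum.If_cases Int_def)
  then show ?thesis by simp
qed

lemma gnp_markov:
  assumes "\<And>g. 0 \<le> f g" "0 < c"
  shows "measure_pmf.prob (gnp n p) {g. c \<le> f g} \<le> measure_pmf.expectation (gnp n p) f / c"
  using integral_Markov_inequality_measure[of "measure_pmf (gnp n p)" f "{}" c] assms by simp

section \<open>First moments of the layers\<close>

locale random_sweep =
  fixes n :: nat and p :: real and x :: "nat \<Rightarrow> nat" and k s :: nat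
  assumes p_nonneg: "0 \<le> p" and p_le_1: "p \<le> 1"
    and x_less: "\<And>i. i < s \<Longrightarrow> x i < n" and inj_x: "inj_on x {..<s}"
begin

abbreviation pr :: "config set \<Rightarrow> real" where "pr \<equiv> measure_pmf.prob (gnp n p)"
abbreviation ex :: "(config \<Rightarrow> real) \<Rightarrow> real" where "ex \<equiv> measure_pmf.expectation (gnp n p)"
abbreviation st :: "config \<Rightarrow> nat \<Rightarrow> nat \<Rightarrow> nat set \<times> nat set \<times> nat set" where
  "st g i j \<equiv> stage n g x k i j"

lemma layer_subset: "i < s \<Longrightarrow> layer (st g i j) \<subseteq> {..<n}"
  using stage_bounded(2)[of i x n g k j] x_less by (meson le_less_trans)

lemma discovered_subset: "i < s \<Longrightarrow> discovered (st g i j) \<subseteq> {..<n}"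
  using stage_bounded(1)[of i x n g k j] x_less by (meson le_less_trans)

lemma layer_Suc:
  "layer (st g i (Suc j)) = {v. v < n \<and> v \<notin> discovered (st g i j) \<and> (\<exists>u\<in>layer (st g i j). adj n g u v)}"
  by (simp add: stage_def bfs_Suc_simps(3))

lemma stage_mix: "stage n (mix (processed (st g i j)) g h) x k i j = st g i j"
  by (rule stage_determined) (auto simp: adj_mix)

text \<open>The pairs that decide the next layer join the current layer to undiscovered vertices.
  Neither end is processed, so only the fresh sample \<open>h\<close> counts, while the history is
  that of \<open>g\<close>.\<close>

lemma layer_Suc_mix:
  "layer (stage n (mix (processed (st g i j)) g h) x k i (Suc j))
    = {v. v < n \<and> v \<notin> discovered (st g i j) \<and> (\<exists>u\<in>layer (st g i j). adj n h u v)}"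
proof -
  have "u \<notin> processed (st g i j)" if "u \<in> layer (st g i j)" for u
    using that stage_invariant(3)[of n g x k i j] by blast
  moreover have "v \<notin> processed (st g i j)" if "v \<notin> discovered (st g i j)" for v
    using that stage_invariant(1)[of n g x k i j] by blast
  ultimately show ?thesis unfolding layer_Suc stage_mix by (auto simp: adj_mix)
qed

lemma processed_determined:
  "(\<And>u v. u \<in> processed (st g i j) \<Longrightarrow> adj n g u v = adj n h u v) \<Longrightarrow> processed (st h i j) = processed (st g i j)"
  using stage_determined[of n g x k i j h] by simp

text \<open>Given the first \<open>j\<close> layers, \<open>v\<close> can enter the next one only
  through a fresh edge to the current layer; the union bound over that layer is then
  averaged.\<close>

lemma prob_layer_Suc_le:
  assumes "i < s"
  shows "pr {g. v \<in> layer (st g i (Suc j))} \<le> p * ex (\<lambda>g. card (layer (st g i j)))"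
proof -
  have "pr {g. v \<in> layer (st g i (Suc j))} \<le> ex (\<lambda>g. p * card (layer (st g i j)))"
  proof (rule gnp_resample_le_expectation[where T = "\<lambda>g. processed (st g i j)"])
    fix g
    let ?A = "layer (st g i j)"
    have fin: "finite ?A" using layer_subset[OF assms] by (rule finite_subset) auto
    have "{h. mix (processed (st g i j)) g h \<in> {g. v \<in> layer (st g i (Suc j))}}
        \<subseteq> (\<Union>u\<in>?A. {h. adj n h u v})"
      by (auto simp: layer_Suc_mix)
    then have "pr {h. mix (processed (st g i j)) g h \<in> {g. v \<in> layer (st g i (Suc j))}}
        \<le> pr (\<Union>u\<in>?A. {h. adj n h u v})"
      by (intro measure_pmf.finite_measure_mono) auto
    also have "\<dots> \<le> (\<Sum>u\<in>?A. pr {h. adj n h u v})"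
      by (intro measure_pmf.finite_measure_subadditive_finite fin) auto
    also have "\<dots> \<le> (\<Sum>u\<in>?A. p)"
    proof (rule sum_mono)
      fix u
      show "pr {h. adj n h u v} \<le> p"
      proof (cases "u < n \<and> v < n \<and> u \<noteq> v")
        case True
        then have "pr {h. adj n h u v} = pr {h. h (min u v, max u v)}" by (simp add: adj_def)
        then show ?thesis using gnp_prob_edge[OF edge_in_vertex_pairs p_nonneg p_le_1] True by simp
      next
        case False
        then have "{h. adj n h u v} = {}" by (auto simp: adj_def)
        then show ?thesis using p_nonneg by simp
      qed
    qed
    finally show "pr {h. mix (processed (st g i j)) g h \<in> {g. v \<in> layer (st g i (Suc j))}} \<le> p * card ?A"
      by (simp add: mult.commute)
  qed (rule processed_determined)
  then show ?thesis by simp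
qed

lemma expectation_layer_le:
  assumes "i < s"
  shows "ex (\<lambda>g. card (layer (st g i j))) \<le> (n * p) ^ j"
proof (induction j)
  case 0
  have "real (card (layer (st g i 0))) \<le> 1" for g
    using card_mono[of "{x i}" "layer (st g i 0)"] by (auto simp: stage_def)
  then have "ex (\<lambda>g. card (layer (st g i 0))) \<le> ex (\<lambda>_. 1)" by (intro integral_mono) auto
  then show ?case by simp
next
  case (Suc j)
  have "layer (st g i (Suc j)) = {v\<in>{..<n}. v \<in> layer (st g i (Suc j))}" for g
    using layer_subset[OF assms] by auto
  then have "ex (\<lambda>g. card (layer (st g i (Suc j)))) = ex (\<lambda>g. card {v\<in>{..<n}. v \<in> layer (st g i (Suc j))})"
    by simp
  also have "\<dots> = (\<Sum>v<n. pr {g. v \<in> layer (st g i (Suc j))})"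
    by (rule expectation_card) simp
  also have "\<dots> \<le> (\<Sum>v<n. p * (n * p) ^ j)"
    by (intro sum_mono order.trans[OF prob_layer_Suc_le[OF assms]] mult_left_mono Suc p_nonneg)
  finally show ?case by (simp add: mult_ac)
qed

lemma prob_layer_le: "i < s \<Longrightarrow> pr {g. v \<in> layer (st g i (Suc j))} \<le> p * (n * p) ^ j"
  by (intro order.trans[OF prob_layer_Suc_le] mult_left_mono expectation_layer_le p_nonneg)

text \<open>Layer \<open>t + 1\<close> contributes \<open>p * (n * p) ^ t\<close>, and
  \<open>v \<noteq> x i\<close> excludes layer 0; hence the sum stops before
  \<open>m\<close>.\<close>

lemma prob_layers_le:
  assumes "i < s" "v \<noteq> x i"
  shows "pr {g. \<exists>t\<le>m. v \<in> layer (st g i t)} \<le> (\<Sum>t<m. p * (n * p) ^ t)"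
proof -
  have "{g. \<exists>t\<le>m. v \<in> layer (st g i t)} \<subseteq> (\<Union>t<m. {g. v \<in> layer (st g i (Suc t))})"
  proof
    fix g assume "g \<in> {g. \<exists>t\<le>m. v \<in> layer (st g i t)}"
    then obtain t where t: "t \<le> m" "v \<in> layer (st g i t)" by auto
    with assms have "t \<noteq> 0" by (cases t) (auto simp: stage_def)
    with t show "g \<in> (\<Union>t<m. {g. v \<in> layer (st g i (Suc t))})"
      by (auto simp: gr0_conv_Suc intro!: bexI[of _ "t - 1"])
  qed
  then have "pr {g. \<exists>t\<le>m. v \<in> layer (st g i t)} \<le> pr (\<Union>t<m. {g. v \<in> layer (st g i (Suc t))})"
    by (intro measure_pmf.finite_measure_mono) auto
  also have "\<dots> \<le> (\<Sum>t<m. pr {g. v \<in> layer (st g i (Suc t))})"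
    by (intro measure_pmf.finite_measure_subadditive_finite) auto
  also have "\<dots> \<le> (\<Sum>t<m. p * (n * p) ^ t)" by (intro sum_mono prob_layer_le assms)
  finally show ?thesis .
qed

text \<open>A centre swallowed by an earlier ball has an empty layer 0, which would stop its growth
  at once. Distinctness of the centres keeps \<open>x i\<close> out of the initial layers of the
  earlier balls.\<close>

lemma prob_source_discovered_le:
  assumes "i < s"
  shows "pr {g. x i \<in> snd (sweep n g x k i)} \<le> s * (\<Sum>t<k. p * (n * p) ^ t)"
proof -
  have "pr {g. x i \<in> snd (sweep n g x k i)} = pr (\<Union>i'<i. {g. \<exists>t\<le>k. x i \<in> layer (st g i' t)})"
    unfolding sweep_discovered_eq by (intro arg_cong[of _ _ pr]) auto
  also have "\<dots> \<le> (\<Sum>i'<i. pr {g. \<exists>t\<le>k. x i \<in> layer (st g i' t)})"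
    by (intro measure_pmf.finite_measure_subadditive_finite) auto
  also have "\<dots> \<le> (\<Sum>i'<i. \<Sum>t<k. p * (n * p) ^ t)"
    using assms inj_onD[OF inj_x, of i] by (intro sum_mono prob_layers_le) fastforce+
  also have "\<dots> \<le> s * (\<Sum>t<k. p * (n * p) ^ t)"
    using assms p_nonneg by (simp, intro mult_right_mono sum_nonneg) auto
  finally show ?thesis .
qed

lemma expectation_discovered_le:
  "ex (\<lambda>g. card (snd (sweep n g x k s))) \<le> s * (\<Sum>t\<le>k. (n * p) ^ t)"
proof -
  have "real (card (snd (sweep n g x k s))) \<le> (\<Sum>i<s. \<Sum>t\<le>k. real (card (layer (st g i t))))" for g
  proof -
    have "card (snd (sweep n g x k s)) \<le> (\<Sum>i<s. card (\<Union>t\<le>k. layer (st g i t)))"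
      unfolding sweep_discovered_eq by (rule card_UN_le) auto
    also have "\<dots> \<le> (\<Sum>i<s. \<Sum>t\<le>k. card (layer (st g i t)))"
      by (intro sum_mono card_UN_le) auto
    finally show ?thesis by (simp flip: of_nat_sum)
  qed
  then have "ex (\<lambda>g. card (snd (sweep n g x k s))) \<le> ex (\<lambda>g. \<Sum>i<s. \<Sum>t\<le>k. real (card (layer (st g i t))))"
    by (intro integral_mono) auto
  also have "\<dots> = (\<Sum>i<s. \<Sum>t\<le>k. ex (\<lambda>g. card (layer (st g i t))))" by simp
  also have "\<dots> \<le> (\<Sum>i<s. \<Sum>t\<le>k. (n * p) ^ t)" by (intro sum_mono expectation_layer_le) auto
  finally show ?thesis by simp
qed

end

lemma prob_gdist_le:
  assumes "0 \<le> p" "p \<le> 1" "u < n" "u \<noteq> v"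
  shows "measure_pmf.prob (gnp n p) {g. gdist (adj n g) u v \<le> enat m} \<le> (\<Sum>t<m. p * (n * p) ^ t)"
proof -
  \<comment> \<open>With a single centre, stage 0 runs from the empty state, so its layers up to
    \<open>m\<close> make up the whole ball of radius \<open>m\<close> around
    \<open>u\<close>.\<close>
  interpret random_sweep n p "\<lambda>_. u" 0 1
    using assms by unfold_locales (auto simp: inj_on_def)
  have "{g. gdist (adj n g) u v \<le> enat m} \<subseteq> {g. \<exists>t\<le>m. v \<in> layer (st g 0 t)}"
  proof (safe, unfold gdist_le_iff, elim exE conjE)
    fix g j assume "j \<le> m" "has_walk (adj n g) j u v"
    from has_walk_discovered[OF this(2)] this(1) show "\<exists>t\<le>m. v \<in> layer (st g 0 t)"
      unfolding bfs_discovered_eq by (auto simp: stage_def intro: order.trans)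
  qed
  then have "pr {g. gdist (adj n g) u v \<le> enat m} \<le> pr {g. \<exists>t\<le>m. v \<in> layer (st g 0 t)}"
    by (intro measure_pmf.finite_measure_mono) auto
  also have "\<dots> \<le> (\<Sum>t<m. p * (n * p) ^ t)" using assms by (intro prob_layers_le) auto
  finally show ?thesis .
qed

section \<open>Growth of the layers\<close>

text \<open>The variance of a count of pairwise independent events is the same as under full
  independence. Second moments are strong enough later on, because the layers grow geometrically and
  the resulting failure bounds can be summed over the steps.\<close>

lemma pairwise_independent_Chebyshev:
  fixes M :: "'a pmf" and Y :: "'b \<Rightarrow> 'a set" and q t :: real
  assumes fin: "finite I"
    and q: "\<And>v. v \<in> I \<Longrightarrow> measure_pmf.prob M (Y v) = q"
    and qq: "\<And>v w. v \<in> I \<Longrightarrow> w \<in> I \<Longrightarrow> v \<noteq> w \<Longrightarrow> measure_pmf.prob M (Y v \<inter> Y w) = q\<^sup>2"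
    and t: "0 < t"
  shows "measure_pmf.prob M {a. t \<le> \<bar>real (card {v\<in>I. a \<in> Y v}) - card I * q\<bar>} \<le> card I * q * (1 - q) / t\<^sup>2"
proof -
  define X where "X a = real (card {v\<in>I. a \<in> Y v})" for a
  have X: "X a = (\<Sum>v\<in>I. indicator (Y v) a)" for a
    unfolding X_def using fin by (simp add: indicator_def sum.If_cases Int_def)
  have X_le: "X a \<le> card I" "0 \<le> X a" for a
    unfolding X_def using fin by (auto intro: card_mono)
  have int2: "integrable M (\<lambda>a. (X a)\<^sup>2)"
    using X_le by (intro measure_pmf.integrable_const_bound[of _ "(card I)\<^sup>2"]) (auto intro!: power_mono)
  have int: "integrable M X"
    using X_le by (intro measure_pmf.integrable_const_bound[of _ "card I"]) auto
  have ind: "integrable M (indicat_real A)" for A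
    by (intro measure_pmf.integrable_const_bound[of _ 1]) auto
  have EX: "measure_pmf.expectation M X = card I * q"
    unfolding X using q by (simp add: ind Bochner_Integration.integral_sum)
  have "(X a)\<^sup>2 = (\<Sum>v\<in>I. \<Sum>w\<in>I. indicator (Y v \<inter> Y w) a)" for a
    unfolding X power2_eq_square sum_product by (simp add: indicator_inter_arith)
  then have "measure_pmf.expectation M (\<lambda>a. (X a)\<^sup>2) = (\<Sum>v\<in>I. \<Sum>w\<in>I. measure_pmf.prob M (Y v \<inter> Y w))"
    by (simp add: ind Bochner_Integration.integral_sum Bochner_Integration.integrable_sum)
  also have "\<dots> = (\<Sum>v\<in>I. q + (real (card I) - 1) * q\<^sup>2)"
  proof (rule sum.cong[OF refl])
    fix v assume v: "v \<in> I"
    have "(\<Sum>w\<in>I. measure_pmf.prob M (Y v \<inter> Y w)) = measure_pmf.prob M (Y v) + (\<Sum>w\<in>I - {v}. measure_pmf.prob M (Y v \<inter> Y w))"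
      using v fin by (subst sum.remove) auto
    also have "\<dots> = q + (\<Sum>w\<in>I - {v}. q\<^sup>2)"
      using v by (intro arg_cong2[of _ _ _ _ "(+)"] sum.cong q qq) auto
    also have "real (card (I - {v})) = real (card I) - 1"
      using v fin by (cases "card I") auto
    then have "(\<Sum>w\<in>I - {v}. q\<^sup>2) = (real (card I) - 1) * q\<^sup>2" by simp
    finally show "(\<Sum>w\<in>I. measure_pmf.prob M (Y v \<inter> Y w)) = q + (real (card I) - 1) * q\<^sup>2" .
  qed
  finally have "measure_pmf.variance M X = card I * q * (1 - q)"
    using int int2 by (subst measure_pmf.variance_eq) (auto simp: EX algebra_simps power2_eq_square)
  then show ?thesis
    using measure_pmf.Chebyshev_inequality[of X M t] int2 t by (simp add: EX) (simp add: X_def)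
qed

text \<open>The unreached vertices are counted instead: \<open>v\<close> is unreached iff the pairs
  \<open>J v\<close> carry no edge. For distinct \<open>v\<close>, \<open>w\<close> outside
  \<open>U\<close> the sets \<open>J v\<close> and \<open>J w\<close> are disjoint because
  \<open>A \<subseteq> U\<close>, which gives pairwise independence.\<close>

lemma gnp_few_neighbours:
  fixes n :: nat and U A :: "nat set" and \<epsilon> p :: real
  defines "\<mu> \<equiv> real (n - card U) * (1 - (1 - p) ^ card A)"
  assumes AU: "A \<subseteq> U" "U \<subseteq> {..<n}" and p: "0 \<le> p" "p \<le> 1" and \<epsilon>: "0 < \<epsilon>" and \<mu>: "0 < \<mu>"
  shows "measure_pmf.prob (gnp n p)
      {h. real (card {v. v < n \<and> v \<notin> U \<and> (\<exists>u\<in>A. adj n h u v)}) < (1 - \<epsilon>) * \<mu>} \<le> 1 / (\<epsilon>\<^sup>2 * \<mu>)"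
proof -
  define I where "I = {..<n} - U"
  define q where "q = (1 - p) ^ card A"
  define J where "J v = (\<lambda>u. (min u v, max u v)) ` A" for v
  define Y where "Y v = {h :: config. \<forall>u\<in>A. \<not> adj n h u v}" for v
  have fin: "finite U" "finite A" "finite I"
    using AU by (auto simp: I_def intro: finite_subset)
  have cI: "card I = n - card U" unfolding I_def using AU fin by (simp add: card_Diff_subset)
  have q01: "0 \<le> q" "q \<le> 1" using p by (auto simp: q_def intro: power_le_one)
  have J: "J v \<subseteq> vertex_pairs n" "card (J v) = card A" "Y v = {h. \<forall>e\<in>J v. \<not> h e}" if "v \<in> I" for v
  proof -
    have ne: "u < n \<and> u \<noteq> v" if "u \<in> A" for u using that \<open>v \<in> I\<close> AU by (auto simp: I_def)
    show "J v \<subseteq> vertex_pairs n" using ne that by (auto simp: J_def I_def intro: edge_in_vertex_pairs)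
    have "inj_on (\<lambda>u. (min u v, max u v)) A" by (auto simp: inj_on_def min_def max_def split: if_splits)
    then show "card (J v) = card A" by (simp add: J_def card_image)
    show "Y v = {h. \<forall>e\<in>J v. \<not> h e}" using ne that by (auto simp: Y_def J_def adj_def I_def)
  qed
  have PY: "measure_pmf.prob (gnp n p) (Y v) = q" if "v \<in> I" for v
    using J[OF that] p by (simp add: gnp_prob_no_edges q_def)
  have PYY: "measure_pmf.prob (gnp n p) (Y v \<inter> Y w) = q\<^sup>2" if "v \<in> I" "w \<in> I" "v \<noteq> w" for v w
  proof -
    have "J v \<inter> J w = {}" using that AU by (auto simp: J_def I_def min_def max_def split: if_splits)
    then have "card (J v \<union> J w) = 2 * card A"
      using J(2)[of v] J(2)[of w] that fin by (subst card_Un_disjoint) (auto simp: J_def)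
    moreover have "Y v \<inter> Y w = {h. \<forall>e\<in>J v \<union> J w. \<not> h e}" using J(3) that by auto
    ultimately show ?thesis
      using J(1)[of v] J(1)[of w] that p by (simp add: gnp_prob_no_edges q_def power_mult power2_eq_square power_add mult_2)
  qed
  have \<mu>': "\<mu> = card I * (1 - q)" by (simp add: \<mu>_def cI q_def)
  have hits: "real (card {v. v < n \<and> v \<notin> U \<and> (\<exists>u\<in>A. adj n h u v)}) = card I - real (card {v\<in>I. h \<in> Y v})" for h
  proof -
    have "{v. v < n \<and> v \<notin> U \<and> (\<exists>u\<in>A. adj n h u v)} = I - {v\<in>I. h \<in> Y v}"
      by (auto simp: I_def Y_def)
    moreover have "card (I - {v\<in>I. h \<in> Y v}) = card I - card {v\<in>I. h \<in> Y v}"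
      using fin by (intro card_Diff_subset) auto
    moreover have "card {v\<in>I. h \<in> Y v} \<le> card I" using fin by (intro card_mono) auto
    ultimately show ?thesis by (simp add: of_nat_diff)
  qed
  have "{h. real (card {v. v < n \<and> v \<notin> U \<and> (\<exists>u\<in>A. adj n h u v)}) < (1 - \<epsilon>) * \<mu>}
      \<subseteq> {h. \<epsilon> * \<mu> \<le> \<bar>real (card {v\<in>I. h \<in> Y v}) - card I * q\<bar>}"
    unfolding hits by (auto simp: \<mu>' algebra_simps)
  then have "measure_pmf.prob (gnp n p) {h. real (card {v. v < n \<and> v \<notin> U \<and> (\<exists>u\<in>A. adj n h u v)}) < (1 - \<epsilon>) * \<mu>}
      \<le> measure_pmf.prob (gnp n p) {h. \<epsilon> * \<mu> \<le> \<bar>real (card {v\<in>I. h \<in> Y v}) - card I * q\<bar>}"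
    by (intro measure_pmf.finite_measure_mono) auto
  also have "\<dots> \<le> card I * q * (1 - q) / (\<epsilon> * \<mu>)\<^sup>2"
    using \<epsilon> \<mu> by (intro pairwise_independent_Chebyshev fin PY PYY) auto
  also have "\<dots> = q * \<mu> / (\<epsilon> * \<mu>)\<^sup>2" by (simp add: \<mu>' mult_ac)
  also have "\<dots> \<le> 1 * \<mu> / (\<epsilon> * \<mu>)\<^sup>2"
    using q01 \<mu> by (intro divide_right_mono mult_right_mono) auto
  also have "\<dots> = 1 / (\<epsilon>\<^sup>2 * \<mu>)" using \<mu> \<epsilon> by (simp add: power2_eq_square field_simps)
  finally show ?thesis .
qed

lemma one_minus_power_ge:
  fixes p a :: real
  assumes "0 \<le> p" "p \<le> 1" "0 \<le> a" "a \<le> real m" "p * a \<le> \<delta>"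
  shows "p * a * (1 - \<delta>) \<le> 1 - (1 - p) ^ m"
proof -
  define y where "y = p * a"
  have y: "0 \<le> y" "y \<le> \<delta>" using assms by (auto simp: y_def)
  have "(1 - p) ^ m \<le> exp (- p) ^ m"
    using assms exp_ge_add_one_self[of "- p"] by (intro power_mono) auto
  also have "\<dots> = exp (- (p * m))" by (simp add: exp_of_nat_mult[symmetric] mult.commute)
  also have "\<dots> \<le> exp (- y)" using assms by (auto simp: y_def intro: mult_left_mono)
  also have "\<dots> = 1 / exp y" by (simp add: exp_minus inverse_eq_divide)
  also have "\<dots> \<le> 1 / (1 + y)" using y exp_ge_add_one_self[of y] by (intro divide_left_mono) auto
  also have "\<dots> \<le> 1 - y * (1 - y)"
  proof -
    \<comment> \<open>The product expands to \<open>1 + y^3\<close>.\<close>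
    have "1 \<le> (1 - y * (1 - y)) * (1 + y)" using y by (simp add: algebra_simps power2_eq_square)
    then show ?thesis using y by (simp add: divide_le_eq)
  qed
  also have "\<dots> \<le> 1 - y * (1 - \<delta>)" using y by (simp add: mult_left_mono)
  finally show ?thesis by (simp add: y_def)
qed

context random_sweep
begin

text \<open>One factor \<open>1 - \<delta>\<close> accounts for at most \<open>\<delta> * n\<close>
  forbidden vertices, the other for vertices with several neighbours in the layer, controlled by
  \<open>p * a \<le> \<delta>\<close>. Once the run up to layer \<open>j\<close> is revealed, either
  its sizes already violate the event or \<open>gnp_few_neighbours\<close> applies to the fresh
  pairs.\<close>

lemma prob_growth_failure:
  fixes a \<delta> \<epsilon> :: real
  assumes i: "i < s" and \<epsilon>: "0 < \<epsilon>" "\<epsilon> \<le> 1" and \<delta>: "\<delta> < 1" and a: "0 < a" "p * a \<le> \<delta>"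
    and pos: "0 < p" "0 < n"
  shows "pr {g. card (discovered (st g i j)) \<le> \<delta> * n \<and> a \<le> card (layer (st g i j))
      \<and> card (layer (st g i (Suc j))) < (1 - \<epsilon>) * ((1 - \<delta>)\<^sup>2 * (n * p) * a)}
    \<le> 1 / (\<epsilon>\<^sup>2 * ((1 - \<delta>)\<^sup>2 * (n * p) * a))" (is "pr ?E \<le> 1 / (\<epsilon>\<^sup>2 * ?m)")
proof (rule gnp_resample_le[where T = "\<lambda>g. processed (st g i j)"])
  have m_pos: "0 < ?m" using assms by simp
  fix g
  let ?A = "layer (st g i j)" and ?U = "discovered (st g i j)"
  define \<mu> where "\<mu> = real (n - card ?U) * (1 - (1 - p) ^ card ?A)"
  show "pr {h. mix (processed (st g i j)) g h \<in> ?E} \<le> 1 / (\<epsilon>\<^sup>2 * ?m)"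
  proof (cases "card ?U \<le> \<delta> * n \<and> a \<le> card ?A")
    case False
    then have "pr {h. mix (processed (st g i j)) g h \<in> ?E} = pr {}"
      by (intro arg_cong[of _ _ pr]) (auto simp: stage_mix)
    also have "\<dots> \<le> 1 / (\<epsilon>\<^sup>2 * ?m)" using m_pos by simp
    finally show ?thesis .
  next
    case True
    have "card ?U \<le> n" using card_mono[OF _ discovered_subset[OF i]] by simp
    then have N: "(1 - \<delta>) * n \<le> real (n - card ?U)"
      using True by (simp add: of_nat_diff algebra_simps)
    have r: "p * a * (1 - \<delta>) \<le> 1 - (1 - p) ^ card ?A"
      using True a p_nonneg p_le_1 by (intro one_minus_power_ge) auto
    have "?m = ((1 - \<delta>) * n) * (p * a * (1 - \<delta>))" by (simp add: power2_eq_square)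
    also have "\<dots> \<le> \<mu>" unfolding \<mu>_def using assms N r by (intro mult_mono) auto
    finally have m_le: "?m \<le> \<mu>" .
    have "{h. mix (processed (st g i j)) g h \<in> ?E}
        \<subseteq> {h. card {v. v < n \<and> v \<notin> ?U \<and> (\<exists>u\<in>?A. adj n h u v)} < (1 - \<epsilon>) * \<mu>}"
      using mult_left_mono[OF m_le, of "1 - \<epsilon>"] \<epsilon> by (auto simp: layer_Suc_mix)
    then have "pr {h. mix (processed (st g i j)) g h \<in> ?E}
        \<le> pr {h. card {v. v < n \<and> v \<notin> ?U \<and> (\<exists>u\<in>?A. adj n h u v)} < (1 - \<epsilon>) * \<mu>}"
      by (intro measure_pmf.finite_measure_mono) auto
    also have "\<dots> \<le> 1 / (\<epsilon>\<^sup>2 * \<mu>)"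
      using less_le_trans[OF m_pos m_le] unfolding \<mu>_def
      by (intro gnp_few_neighbours stage_invariant(2) discovered_subset i p_nonneg p_le_1 \<epsilon>)
    also have "\<dots> \<le> 1 / (\<epsilon>\<^sup>2 * ?m)"
      using m_le m_pos \<epsilon> a pos less_le_trans[OF m_pos m_le]
      by (intro divide_left_mono mult_left_mono mult_pos_pos) auto
    finally show ?thesis .
  qed
qed (rule processed_determined)

end

text \<open>The size that the \<open>j\<close>-th layer reaches when the relative loss in step \<open>j\<close>
  is at most \<open>2\<^sup>-\<^sup>j\<^sup>-\<^sup>2\<close>, up to the fraction \<open>\<delta>\<close> of forbidden vertices.\<close>
definition growth_bound :: "real \<Rightarrow> real \<Rightarrow> nat \<Rightarrow> real" where
  "growth_bound \<delta> \<Lambda> j = \<Lambda> ^ j * (1 - \<delta>) ^ (2 * j) * (1/2 + (1/2) ^ Suc j)"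

lemma growth_bound_0 [simp]: "growth_bound \<delta> \<Lambda> 0 = 1"
  by (simp add: growth_bound_def)

lemma growth_bound_Suc_le:
  assumes "0 \<le> \<Lambda>" "\<delta> \<le> 1"
  shows "growth_bound \<delta> \<Lambda> (Suc j) \<le> (1 - (1/2) ^ (j + 2)) * ((1 - \<delta>)\<^sup>2 * \<Lambda> * growth_bound \<delta> \<Lambda> j)"
proof -
  \<comment> \<open>In terms of \<open>h\<close> the bracket in \<open>growth_bound\<close> shrinks
    from \<open>1/2 + 2 * h\<close> to \<open>1/2 + h\<close>. The loss factor \<open>1 - h\<close>
    allows this because \<open>h \<le> 1/4\<close>.\<close>
  define h :: real where "h = (1/2) ^ (j + 2)"
  have "h \<le> (1/2) ^ 2" unfolding h_def by (rule power_decreasing) auto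
  then have h: "0 \<le> h" "h \<le> 1/4" by (auto simp: h_def power2_eq_square)
  have "h * h \<le> 1/4 * h" using h by (intro mult_right_mono) auto
  moreover have "(1 - h) * (1/2 + 2 * h) = 1/2 + 3/2 * h - 2 * (h * h)" by (simp add: field_simps)
  ultimately have "1/2 + h \<le> (1 - h) * (1/2 + 2 * h)" by linarith
  then have "\<Lambda> ^ Suc j * (1 - \<delta>) ^ (2 * Suc j) * (1/2 + h)
      \<le> \<Lambda> ^ Suc j * (1 - \<delta>) ^ (2 * Suc j) * ((1 - h) * (1/2 + 2 * h))"
    using assms by (intro mult_left_mono) auto
  also have "\<dots> = (1 - h) * ((1 - \<delta>)\<^sup>2 * \<Lambda> * (\<Lambda> ^ j * (1 - \<delta>) ^ (2 * j) * (1/2 + 2 * h)))"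
    by (simp add: power2_eq_square)
  finally show ?thesis by (simp add: growth_bound_def h_def)
qed

text \<open>One factor \<open>1/2\<close> pays for the forbidden vertices in all steps together, the
  other for all random fluctuations.\<close>

lemma growth_bound_ge:
  assumes "0 \<le> \<Lambda>" "0 \<le> \<delta>" "\<delta> < 1" "1/2 \<le> (1 - \<delta>) ^ (2 * k)" "j \<le> k"
  shows "\<Lambda> ^ j / 4 \<le> growth_bound \<delta> \<Lambda> j"
proof -
  have "1/2 \<le> (1 - \<delta>) ^ (2 * j)"
    using assms by (intro order.trans[OF assms(4)] power_decreasing) auto
  then have "\<Lambda> ^ j * (1/2) * (1/2) \<le> growth_bound \<delta> \<Lambda> j"
    unfolding growth_bound_def using assms by (intro mult_mono) auto
  then show ?thesis by simp
qed

lemma growth_bound_le: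
  assumes "0 \<le> \<Lambda>" "0 \<le> \<delta>" "\<delta> < 1"
  shows "growth_bound \<delta> \<Lambda> j \<le> \<Lambda> ^ j"
proof -
  have "(1/2 :: real) ^ Suc j \<le> (1/2) ^ 1" by (rule power_decreasing) auto
  then have "growth_bound \<delta> \<Lambda> j \<le> \<Lambda> ^ j * 1 * 1"
    unfolding growth_bound_def using assms by (intro mult_mono power_le_one) auto
  then show ?thesis by simp
qed

lemma sum_powers_less_le:
  fixes \<Lambda> :: real
  assumes "2 \<le> \<Lambda>"
  shows "(\<Sum>t<k. \<Lambda> ^ t) \<le> \<Lambda> ^ k"
proof (induction k)
  case (Suc k)
  have "\<Lambda> ^ k * 2 \<le> \<Lambda> ^ k * \<Lambda>" using assms by (intro mult_left_mono) auto
  with Suc show ?case by (simp add: mult.commute)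
qed auto

lemma sum_powers_le:
  fixes \<Lambda> :: real
  assumes "2 \<le> \<Lambda>"
  shows "(\<Sum>t\<le>k. \<Lambda> ^ t) \<le> 2 * \<Lambda> ^ k"
  using sum_powers_less_le[OF assms, of k] by (simp add: lessThan_Suc_atMost[symmetric])

context random_sweep
begin

text \<open>The layers follow \<open>growth_bound\<close> unless the sweep discovers too much
  (\<open>H\<close>), the centre was swallowed (\<open>K\<close>), or some step fails
  (\<open>F j\<close>). The allowed loss \<open>\<epsilon> j\<close> shrinks, so step
  \<open>j\<close> pays \<open>1 / (\<epsilon> j)\<^sup>2\<close>, of order \<open>4 ^ j\<close>,
  but the layer has grown by at least \<open>8 ^ j\<close>; this is what
  \<open>8 \<le> n * p\<close> is for, and the failures form a geometric series.\<close>

lemma prob_small_layer: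
  fixes \<delta> :: real
  assumes i: "i < s" and \<delta>: "0 < \<delta>" "\<delta> < 1" "1/2 \<le> (1 - \<delta>) ^ (2 * k)"
    and np: "8 \<le> n * p" "p * (n * p) ^ k \<le> \<delta>"
  shows "pr {g. card (layer (st g i k)) < (n * p) ^ k / 4}
    \<le> 2 * s * (n * p) ^ k / (\<delta> * n) + s * p * (n * p) ^ k + 128 / (n * p)"
proof -
  define \<Lambda> where "\<Lambda> = n * p"
  define b where "b = growth_bound \<delta> \<Lambda>"
  define \<epsilon> :: "nat \<Rightarrow> real" where "\<epsilon> j = (1/2) ^ (j + 2)" for j
  define F where "F j = {g. card (discovered (st g i j)) \<le> \<delta> * n \<and> b j \<le> card (layer (st g i j))
      \<and> card (layer (st g i (Suc j))) < (1 - \<epsilon> j) * ((1 - \<delta>)\<^sup>2 * \<Lambda> * b j)}" for j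
  \<comment> \<open>Measured at the end of the sweep, so that a single Markov bound controls every
    intermediate discovered set.\<close>
  define H where "H = {g. \<delta> * n \<le> card (snd (sweep n g x k s))}"
  define K where "K = {g. x i \<in> snd (sweep n g x k i)}"
  have "p \<noteq> 0" "n \<noteq> 0" using np(1) by (intro notI; simp)+
  then have pos: "0 < p" "0 < n" using p_nonneg by simp_all
  have \<Lambda>: "8 \<le> \<Lambda>" using np by (simp add: \<Lambda>_def)
  have "{g. card (layer (st g i k)) < \<Lambda> ^ k / 4} \<subseteq> H \<union> K \<union> (\<Union>j<k. F j)"
  proof (rule subsetI, rule ccontr)
    fix g assume g: "g \<in> {g. card (layer (st g i k)) < \<Lambda> ^ k / 4}" "g \<notin> H \<union> K \<union> (\<Union>j<k. F j)"
    have grow: "b j \<le> card (layer (st g i j))" if "j \<le> k" for j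
      using that
    proof (induction j)
      case 0
      have "{x i} - snd (sweep n g x k i) = {x i}" using g by (auto simp: K_def)
      then show ?case by (simp add: stage_def b_def)
    next
      case (Suc j)
      have "card (discovered (st g i j)) \<le> card (snd (sweep n g x k s))"
        using i Suc.prems sweep_bounded[of s x n g k] x_less
        by (intro card_mono stage_subset_sweep) (auto intro: finite_subset)
      then have "card (discovered (st g i j)) \<le> \<delta> * n" using g by (auto simp: H_def)
      with Suc g have "(1 - \<epsilon> j) * ((1 - \<delta>)\<^sup>2 * \<Lambda> * b j) \<le> card (layer (st g i (Suc j)))"
        by (auto simp: F_def not_less)
      moreover have "b (Suc j) \<le> (1 - \<epsilon> j) * ((1 - \<delta>)\<^sup>2 * \<Lambda> * b j)"
        unfolding b_def \<epsilon>_def using \<Lambda> \<delta> by (intro growth_bound_Suc_le) auto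
      ultimately show ?case by linarith
    qed
    have "\<Lambda> ^ k / 4 \<le> b k" unfolding b_def using \<Lambda> \<delta> by (intro growth_bound_ge[of _ _ k]) auto
    with grow[of k] g show False by auto
  qed
  then have "pr {g. card (layer (st g i k)) < \<Lambda> ^ k / 4} \<le> pr (H \<union> K \<union> (\<Union>j<k. F j))"
    by (intro measure_pmf.finite_measure_mono) auto
  also have "\<dots> \<le> pr H + pr K + pr (\<Union>j<k. F j)"
    using measure_subadditive[of "H \<union> K" "measure_pmf (gnp n p)" "\<Union>j<k. F j"]
      measure_subadditive[of H "measure_pmf (gnp n p)" K]
    by (simp add: measure_pmf.emeasure_eq_measure)
  also have "pr H \<le> 2 * s * \<Lambda> ^ k / (\<delta> * n)"
  proof -
    have "pr H \<le> ex (\<lambda>g. card (snd (sweep n g x k s))) / (\<delta> * n)"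
      unfolding H_def using \<delta> pos by (intro gnp_markov) auto
    also have "\<dots> \<le> s * (\<Sum>t\<le>k. \<Lambda> ^ t) / (\<delta> * n)"
      using expectation_discovered_le \<delta> pos unfolding \<Lambda>_def by (intro divide_right_mono) auto
    also have "\<dots> \<le> s * (2 * \<Lambda> ^ k) / (\<delta> * n)"
      using \<delta> pos \<Lambda> by (intro divide_right_mono mult_left_mono sum_powers_le) auto
    finally show ?thesis by (simp add: mult_ac)
  qed
  also have "pr K \<le> s * p * \<Lambda> ^ k"
  proof -
    have "pr K \<le> s * (\<Sum>t<k. p * \<Lambda> ^ t)"
      unfolding K_def \<Lambda>_def by (rule prob_source_discovered_le[OF i])
    also have "\<dots> = s * p * (\<Sum>t<k. \<Lambda> ^ t)" by (simp add: sum_distrib_left mult_ac)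
    also have "\<dots> \<le> s * p * \<Lambda> ^ k"
      using \<Lambda> p_nonneg by (intro mult_left_mono sum_powers_less_le) auto
    finally show ?thesis .
  qed
  also have "pr (\<Union>j<k. F j) \<le> 128 / \<Lambda>"
  proof -
    have "pr (\<Union>j<k. F j) \<le> (\<Sum>j<k. pr (F j))"
      by (intro measure_pmf.finite_measure_subadditive_finite) auto
    also have "\<dots> \<le> (\<Sum>j<k. 64 / \<Lambda> * (1/2) ^ j)"
    proof (rule sum_mono)
      fix j assume "j \<in> {..<k}"
      then have j: "j < k" by simp
      have b_pos: "\<Lambda> ^ j / 4 \<le> b j"
        unfolding b_def using \<Lambda> \<delta> j by (intro growth_bound_ge[of _ _ k]) auto
      have b_pos': "0 < b j" using b_pos \<Lambda> by (smt (verit) zero_less_power divide_pos_pos)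
      have "b j \<le> \<Lambda> ^ j" unfolding b_def using \<Lambda> \<delta> by (intro growth_bound_le) auto
      also have "\<dots> \<le> \<Lambda> ^ k" using \<Lambda> j by (intro power_increasing) auto
      finally have pb: "p * b j \<le> \<delta>"
        using mult_left_mono[of "b j" "\<Lambda> ^ k" p] np p_nonneg by (simp add: \<Lambda>_def)
      have \<epsilon>: "0 < \<epsilon> j" "\<epsilon> j \<le> 1" unfolding \<epsilon>_def by (simp, rule power_le_one, auto)
      define m where "m = (1 - \<delta>)\<^sup>2 * \<Lambda> * b j"
      have "pr (F j) \<le> 1 / ((\<epsilon> j)\<^sup>2 * m)"
        unfolding F_def m_def \<Lambda>_def using \<delta> pos pb b_pos'
        by (intro prob_growth_failure i) (auto simp: \<epsilon>)
      also have "\<dots> \<le> 64 / \<Lambda> * (1/2) ^ j"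
      proof -
        have "1/2 \<le> (1 - \<delta>) ^ (2 * Suc j)"
          using \<delta> j by (intro order.trans[OF \<delta>(3)] power_decreasing) auto
        then have "\<Lambda> ^ Suc j * (1/2) * (1/2) \<le> \<Lambda> ^ Suc j * (1 - \<delta>) ^ (2 * Suc j) * (1/2 + (1/2) ^ Suc j)"
          using \<Lambda> by (intro mult_mono) auto
        also have "\<dots> = m" by (simp add: m_def b_def growth_bound_def power2_eq_square)
        finally have m: "\<Lambda> ^ Suc j / 4 \<le> m" by simp
        have "8 ^ j \<le> \<Lambda> ^ j" using \<Lambda> by (intro power_mono) auto
        then have "\<Lambda> * 8 ^ j / 4 \<le> \<Lambda> ^ Suc j / 4" using \<Lambda> by simp
        with m have m': "\<Lambda> * 8 ^ j / 4 \<le> m" by linarith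
        have "(\<epsilon> j)\<^sup>2 = (1/2 * (1/2)) ^ (j + 2)"
          unfolding \<epsilon>_def power2_eq_square by (rule power_mult_distrib[symmetric])
        then have eps: "(\<epsilon> j)\<^sup>2 = 1 / (16 * 4 ^ j)" by (simp add: power_add power_divide power2_eq_square)
        have eight: "(8 :: real) ^ j = 2 ^ j * 4 ^ j" by (simp flip: power_mult_distrib)
        have "(\<epsilon> j)\<^sup>2 * (\<Lambda> * 8 ^ j / 4) = \<Lambda> * 2 ^ j / 64"
          unfolding eps eight by simp
        moreover have "(\<epsilon> j)\<^sup>2 * (\<Lambda> * 8 ^ j / 4) \<le> (\<epsilon> j)\<^sup>2 * m"
          using m' by (intro mult_left_mono) auto
        ultimately have "\<Lambda> * 2 ^ j / 64 \<le> (\<epsilon> j)\<^sup>2 * m" by linarith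
        then have "1 / ((\<epsilon> j)\<^sup>2 * m) \<le> 1 / (\<Lambda> * 2 ^ j / 64)"
          using \<Lambda> by (intro frac_le) simp_all
        then show ?thesis by (simp add: power_divide)
      qed
      finally show "pr (F j) \<le> 64 / \<Lambda> * (1/2) ^ j" .
    qed
    also have "\<dots> = 64 / \<Lambda> * (\<Sum>j<k. (1/2) ^ j)" by (simp add: sum_distrib_left)
    also have "(\<Sum>j<k. (1/2) ^ j) = (2 :: real) - 2 * (1/2) ^ k" by (induction k) auto
    also have "64 / \<Lambda> * (2 - 2 * (1/2) ^ k) \<le> 64 / \<Lambda> * 2" using \<Lambda> by (intro mult_left_mono) auto
    finally show ?thesis by simp
  qed
  finally show ?thesis by (simp add: \<Lambda>_def)
qed

end

section \<open>Far pairs of centres with large outermost layers\<close>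

lemma card_vertex_pairs: "real (card (vertex_pairs s)) = s * (real s - 1) / 2"
proof (induction s)
  case (Suc s)
  have "vertex_pairs (Suc s) = vertex_pairs s \<union> {..<s} \<times> {s}"
    by (auto simp: vertex_pairs_def)
  moreover have "vertex_pairs s \<inter> {..<s} \<times> {s} = {}" by (auto simp: vertex_pairs_def)
  ultimately have "card (vertex_pairs (Suc s)) = card (vertex_pairs s) + s"
    by (simp add: card_Un_disjoint finite_vertex_pairs)
  with Suc show ?case by (simp add: field_simps)
qed (auto simp: vertex_pairs_def)

context random_sweep
begin

definition good_pairs :: "real \<Rightarrow> config \<Rightarrow> (nat \<times> nat) set" where
  "good_pairs a g = {(i, j) \<in> vertex_pairs s. a \<le> card (layer (st g i k)) \<and> a \<le> card (layer (st g j k))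
    \<and> \<not> gdist (adj n g) (x i) (x j) \<le> enat (2 * k + 1)}"

text \<open>Markov's inequality is applied to the indices with a small layer and to the close pairs.
  Fewer than \<open>s / 16\<close> such indices spoil at most \<open>s^2 / 8\<close> pairs, and the
  close pairs spoil less than \<open>s^2 / 16\<close>. Together with fewer than
  \<open>s^2 / 4\<close> good pairs this falls short of \<open>s * (s - 1) / 2\<close> as soon as
  \<open>8 \<le> s\<close>.\<close>

lemma prob_few_good_pairs:
  fixes a \<eta> \<theta> :: real
  assumes small: "\<And>i. i < s \<Longrightarrow> pr {g. card (layer (st g i k)) < a} \<le> \<eta>"
    and close: "\<And>i j. i < j \<Longrightarrow> j < s \<Longrightarrow> pr {g. gdist (adj n g) (x i) (x j) \<le> enat (2 * k + 1)} \<le> \<theta>"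
    and s: "8 \<le> s"
  shows "pr {g. card (good_pairs a g) < (real s)\<^sup>2 / 4} \<le> 16 * \<eta> + 16 * \<theta>"
proof -
  define B where "B g = {i\<in>{..<s}. card (layer (st g i k)) < a}" for g
  define C where "C g = {e\<in>vertex_pairs s. gdist (adj n g) (x (fst e)) (x (snd e)) \<le> enat (2 * k + 1)}" for g
  have fin: "finite (good_pairs a g)" "finite (B g)" "finite (C g)" for g
    using finite_vertex_pairs[of s] by (auto simp: good_pairs_def B_def C_def intro: finite_subset[rotated])
  have "pr {g. real s / 16 \<le> card (B g)} \<le> ex (\<lambda>g. card (B g)) / (real s / 16)"
    using s by (intro gnp_markov) auto
  also have "ex (\<lambda>g. card (B g)) = (\<Sum>i<s. pr {g. card (layer (st g i k)) < a})"
    unfolding B_def by (rule expectation_card) simp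
  also have "\<dots> / (real s / 16) \<le> (\<Sum>i<s. \<eta>) / (real s / 16)"
    by (intro divide_right_mono sum_mono small) auto
  finally have PB: "pr {g. real s / 16 \<le> card (B g)} \<le> 16 * \<eta>" using s by simp
  have \<theta>: "0 \<le> \<theta>" using close[of 0 1] s by (meson measure_nonneg order.trans zero_less_one less_le_trans one_less_numeral_iff semiring_norm(76))
  have "pr {g. (real s)\<^sup>2 / 16 \<le> card (C g)} \<le> ex (\<lambda>g. card (C g)) / ((real s)\<^sup>2 / 16)"
    using s by (intro gnp_markov) auto
  also have "ex (\<lambda>g. card (C g)) = (\<Sum>e\<in>vertex_pairs s. pr {g. gdist (adj n g) (x (fst e)) (x (snd e)) \<le> enat (2 * k + 1)})"
    unfolding C_def by (rule expectation_card) (rule finite_vertex_pairs)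
  also have "\<dots> \<le> (\<Sum>e\<in>vertex_pairs s. \<theta>)"
    by (intro sum_mono close) (auto simp: vertex_pairs_def)
  also have "\<dots> \<le> (real s)\<^sup>2 * \<theta>"
  proof -
    have "real (card (vertex_pairs s)) \<le> (real s)\<^sup>2"
      unfolding card_vertex_pairs power2_eq_square by (simp add: field_simps)
    then show ?thesis using \<theta> by (simp add: mult_right_mono)
  qed
  finally have PC: "pr {g. (real s)\<^sup>2 / 16 \<le> card (C g)} \<le> 16 * \<theta>"
    using s by (simp add: divide_right_mono field_simps)
  have "{g. card (good_pairs a g) < (real s)\<^sup>2 / 4}
      \<subseteq> {g. real s / 16 \<le> card (B g)} \<union> {g. (real s)\<^sup>2 / 16 \<le> card (C g)}"
  proof (rule subsetI, rule ccontr)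
    fix g assume g: "g \<in> {g. card (good_pairs a g) < (real s)\<^sup>2 / 4}"
      "g \<notin> {g. real s / 16 \<le> card (B g)} \<union> {g. (real s)\<^sup>2 / 16 \<le> card (C g)}"
    have "vertex_pairs s \<subseteq> good_pairs a g \<union> (B g \<times> {..<s} \<union> {..<s} \<times> B g) \<union> C g"
      by (auto simp: good_pairs_def B_def C_def vertex_pairs_def)
    then have "card (vertex_pairs s) \<le> card (good_pairs a g \<union> (B g \<times> {..<s} \<union> {..<s} \<times> B g) \<union> C g)"
      using fin by (intro card_mono) auto
    also have "\<dots> \<le> card (good_pairs a g) + (card (B g \<times> {..<s}) + card ({..<s} \<times> B g)) + card (C g)"
      by (intro order.trans[OF card_Un_le] add_mono order.refl)
    also have "\<dots> = card (good_pairs a g) + 2 * (s * card (B g)) + card (C g)"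
      by (simp add: card_cartesian_product)
    finally have "real (card (vertex_pairs s)) \<le> card (good_pairs a g) + 2 * (s * real (card (B g))) + card (C g)"
      by (metis (no_types, lifting) of_nat_add of_nat_le_iff of_nat_mult of_nat_numeral)
    moreover have "s * real (card (B g)) \<le> s * (s / 16)" using g by (intro mult_left_mono) auto
    ultimately have "s * (real s - 1) / 2 < (real s)\<^sup>2 / 4 + 2 * (s * (s / 16)) + (real s)\<^sup>2 / 16"
      using g unfolding card_vertex_pairs mem_Collect_eq Un_iff by linarith
    then have "s * real s < 8 * s" by (simp add: power2_eq_square algebra_simps)
    then show False using s by simp
  qed
  then have "pr {g. card (good_pairs a g) < (real s)\<^sup>2 / 4}
      \<le> pr ({g. real s / 16 \<le> card (B g)} \<union> {g. (real s)\<^sup>2 / 16 \<le> card (C g)})"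
    by (intro measure_pmf.finite_measure_mono) auto
  also have "\<dots> \<le> pr {g. real s / 16 \<le> card (B g)} + pr {g. (real s)\<^sup>2 / 16 \<le> card (C g)}"
    by (rule measure_subadditive) (auto simp: measure_pmf.emeasure_eq_measure)
  finally show ?thesis using PB PC by linarith
qed

end

section \<open>Counting labels\<close>

lemma sum_two_four_powers: "(\<Sum>l\<le>m. 2 ^ l * 4 ^ (m - l)) + 2 ^ m = (2 * 4 ^ m :: nat)"
proof (induction m)
  case (Suc m)
  have "(\<Sum>l\<le>m. 2 ^ l * 4 ^ (Suc m - l)) = 4 * (\<Sum>l\<le>m. 2 ^ l * 4 ^ (m - l) :: nat)"
    by (auto simp: sum_distrib_left Suc_diff_le intro!: sum.cong)
  with Suc show ?case by simp
qed auto

text \<open>Induction on the number of labels, splitting off a first label of length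
  \<open>l\<close>. Base 4 makes the sum over \<open>l\<close> geometric, at the price of a factor 2
  per label; base 2 would cost a factor \<open>m + 1\<close> each time.\<close>

lemma card_label_lists:
  fixes s m :: nat
  defines "S \<equiv> \<lambda>s m. {ls :: bool list list. length ls = s \<and> sum_list (map length ls) \<le> m}"
  shows "finite (S s m) \<and> card (S s m) \<le> 4 ^ m * 2 ^ s"
proof (induction s arbitrary: m)
  case 0
  have "S 0 m = {[]}" by (auto simp: S_def)
  then show ?case by simp
next
  case (Suc s)
  define W where "W l = {w :: bool list. length w = l}" for l
  have W: "finite (W l)" "card (W l) = 2 ^ l" for l
    using finite_lists_length_eq[of "UNIV :: bool set" l] card_lists_length_eq[of "UNIV :: bool set" l]
    by (auto simp: W_def)
  have eq: "S (Suc s) m = (\<Union>l\<le>m. (\<lambda>(w, ls). w # ls) ` (W l \<times> S s (m - l)))"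
  proof (intro set_eqI iffI)
    fix ls assume "ls \<in> S (Suc s) m"
    then obtain w ls' where "ls = w # ls'" "length ls' = s" "length w + sum_list (map length ls') \<le> m"
      by (cases ls) (auto simp: S_def)
    then show "ls \<in> (\<Union>l\<le>m. (\<lambda>(w, ls). w # ls) ` (W l \<times> S s (m - l)))"
      by (auto simp: S_def W_def intro!: bexI[of _ "length w"])
  qed (auto simp: S_def W_def)
  have "card (S (Suc s) m) \<le> (\<Sum>l\<le>m. card ((\<lambda>(w, ls). w # ls) ` (W l \<times> S s (m - l))))"
    unfolding eq by (rule card_UN_le) simp
  also have "\<dots> \<le> (\<Sum>l\<le>m. 2 ^ l * (4 ^ (m - l) * 2 ^ s))"
  proof (rule sum_mono)
    fix l
    have "card ((\<lambda>(w, ls). w # ls) ` (W l \<times> S s (m - l))) \<le> card (W l \<times> S s (m - l))"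
      using W Suc by (intro card_image_le finite_cartesian_product) auto
    also have "\<dots> \<le> 2 ^ l * (4 ^ (m - l) * 2 ^ s)"
      using Suc[of "m - l"] by (simp add: card_cartesian_product W)
    finally show "card ((\<lambda>(w, ls). w # ls) ` (W l \<times> S s (m - l))) \<le> 2 ^ l * (4 ^ (m - l) * 2 ^ s)" .
  qed
  also have "\<dots> = (\<Sum>l\<le>m. 2 ^ l * 4 ^ (m - l)) * 2 ^ s" unfolding sum_distrib_right by (simp only: mult.assoc)
  also have "\<dots> \<le> (2 * 4 ^ m) * 2 ^ s"
    using sum_two_four_powers[of m] by (intro mult_right_mono) linarith+
  finally have "card (S (Suc s) m) \<le> 4 ^ m * 2 ^ Suc s" by simp
  moreover have "finite (S (Suc s) m)"
    unfolding eq using W Suc by (intro finite_UN_I finite_imageI finite_cartesian_product) auto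
  ultimately show ?case by blast
qed

section \<open>Union bound over the labels of one block\<close>

context random_sweep
begin

text \<open>\<open>R\<close> is fixed before the graph is drawn. Redrawing all pairs away from
  processed vertices changes neither the sweep nor its layers. If \<open>N\<close> index pairs have
  large layers, at least \<open>a^2 * N\<close> vertex pairs cross between outermost layers; they
  are distinct since these layers are disjoint, all of them are fresh, and all must be
  absent.\<close>

lemma prob_no_crossing_edges:
  fixes a N :: real
  assumes R: "R \<subseteq> vertex_pairs s" and a: "0 \<le> a"
  shows "pr {g. N \<le> card {(i, j) \<in> R. a \<le> card (layer (st g i k)) \<and> a \<le> card (layer (st g j k))}
      \<and> (\<forall>(i, j)\<in>R. \<forall>u\<in>layer (st g i k). \<forall>v\<in>layer (st g j k). \<not> adj n g u v)}
    \<le> exp (- (p * a\<^sup>2 * N))" (is "pr ?E \<le> _")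
proof (rule gnp_resample_le[where T = "\<lambda>g. fst (sweep n g x k s)"])
  fix g
  let ?T = "fst (sweep n g x k s)"
  define L where "L i = layer (st g i k)" for i
  define R' where "R' = {(i, j) \<in> R. a \<le> card (L i) \<and> a \<le> card (L j)}"
  have R'_less: "i < j \<and> j < s" if "(i, j) \<in> R'" for i j
    using that R by (auto simp: R'_def vertex_pairs_def)
  have stage_same: "stage n (mix ?T g h) x k i k = st g i k" if "i < s" for h i
    by (rule stage_determined_by_sweep[OF _ that]) (simp add: adj_mix)
  show "pr {h. mix ?T g h \<in> ?E} \<le> exp (- (p * a\<^sup>2 * N))"
  proof (cases "N \<le> card R'")
    case False
    have "pr {h. mix ?T g h \<in> ?E} = pr {}"
    proof (intro arg_cong[of _ _ pr] equals0I, unfold mem_Collect_eq, elim conjE)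
      fix h assume "N \<le> card {(i, j) \<in> R. a \<le> card (layer (stage n (mix ?T g h) x k i k))
          \<and> a \<le> card (layer (stage n (mix ?T g h) x k j k))}"
      also have "{(i, j) \<in> R. a \<le> card (layer (stage n (mix ?T g h) x k i k))
          \<and> a \<le> card (layer (stage n (mix ?T g h) x k j k))} = R'"
        using R by (auto simp: R'_def L_def stage_same vertex_pairs_def)
      finally show False using False by simp
    qed
    then show ?thesis by simp
  next
    case True
    define D where "D = (SIGMA e:R'. L (fst e) \<times> L (snd e))"
    define f where "f = (\<lambda>(e :: nat \<times> nat, u :: nat, v :: nat). (min u v, max u v))"
    have fin: "finite (L i)" "L i \<subseteq> {..<n}" "L i \<inter> ?T = {}" if "i < s" for i
      using layer_subset[OF that, of g k] outer_layer_unprocessed[OF that, of n g x k]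
      by (auto simp: L_def intro: finite_subset)
    have same: "i = j" if "u \<in> L i" "u \<in> L j" for i j u
      using that outer_layers_disjoint[of i j n g x k] outer_layers_disjoint[of j i n g x k]
      by (cases i j rule: linorder_cases) (auto simp: L_def)
    have inj: "inj_on f D"
    proof (rule inj_onI)
      fix d d' assume "d \<in> D" "d' \<in> D" and eq: "f d = f d'"
      then obtain i j u v i' j' u' v' where d: "d = ((i, j), u, v)" "d' = ((i', j'), u', v')"
        "(i, j) \<in> R'" "(i', j') \<in> R'" "u \<in> L i" "v \<in> L j" "u' \<in> L i'" "v' \<in> L j'"
        by (auto simp: D_def)
      from eq have "u = u' \<and> v = v' \<or> u = v' \<and> v = u'"
        by (auto simp: d f_def min_def max_def split: if_splits)
      then show "d = d'"
      proof
        assume "u = u' \<and> v = v'"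
        then show ?thesis using d same by blast
      next
        \<comment> \<open>Disjoint layers determine the indices, so a swap would reverse the order
          \<open>i < j\<close> of an index pair.\<close>
        assume "u = v' \<and> v = u'"
        then have "i = j'" "j = i'" using d same by blast+
        then show ?thesis using R'_less[OF d(3)] R'_less[OF d(4)] by simp
      qed
    qed
    have J: "f ` D \<subseteq> vertex_pairs n"
    proof
      fix e assume "e \<in> f ` D"
      then obtain i j u v where e: "e = (min u v, max u v)" "(i, j) \<in> R'" "u \<in> L i" "v \<in> L j"
        by (auto simp: D_def f_def)
      have ij: "i < j" "j < s" using R'_less[OF e(2)] by auto
      then have "u < n" "v < n" using fin(2)[of i] fin(2)[of j] e by auto
      moreover have "u \<noteq> v" using same e ij by blast
      ultimately show "e \<in> vertex_pairs n" unfolding e by (rule edge_in_vertex_pairs)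
    qed
    have finR': "finite R'" using R finite_vertex_pairs[of s] by (auto simp: R'_def intro: finite_subset)
    have finL: "finite (L (fst e) \<times> L (snd e))" if "e \<in> R'" for e
      using R'_less[of "fst e" "snd e"] that fin(1) by (metis finite_cartesian_product less_trans prod.collapse)
    have "a\<^sup>2 * N \<le> (\<Sum>e\<in>R'. a\<^sup>2)" using True by (simp add: mult.commute mult_right_mono)
    also have "\<dots> \<le> (\<Sum>e\<in>R'. real (card (L (fst e) \<times> L (snd e))))"
      unfolding power2_eq_square card_cartesian_product of_nat_mult using a
      by (intro sum_mono mult_mono) (auto simp: R'_def)
    also have "\<dots> = card D"
    proof -
      have "\<forall>e\<in>R'. finite (L (fst e) \<times> L (snd e))" using finL by blast
      then have "card D = (\<Sum>e\<in>R'. card (L (fst e) \<times> L (snd e)))"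
        unfolding D_def by (rule card_SigmaI[OF finR'])
      then show ?thesis by simp
    qed
    also have "card D = card (f ` D)" using inj by (simp add: card_image)
    finally have cJ: "a\<^sup>2 * N \<le> card (f ` D)" .
    have "{h. mix ?T g h \<in> ?E} \<subseteq> {h. \<forall>e\<in>f ` D. \<not> h e}"
    proof (rule subsetI, unfold mem_Collect_eq, intro ballI, elim conjE)
      fix h e assume e: "e \<in> f ` D"
        and none: "\<forall>(i, j)\<in>R. \<forall>u\<in>layer (stage n (mix ?T g h) x k i k).
          \<forall>v\<in>layer (stage n (mix ?T g h) x k j k). \<not> adj n (mix ?T g h) u v"
      from e obtain i j u v where e: "e = (min u v, max u v)" "(i, j) \<in> R'" "u \<in> L i" "v \<in> L j"
        by (auto simp: D_def f_def)
      have ij: "i < j" "j < s" "i < s" using R'_less[OF e(2)] by auto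
      have "\<not> adj n (mix ?T g h) u v"
        using none e(2-4) ij by (auto simp: R'_def L_def stage_same)
      moreover have "u \<notin> ?T" "v \<notin> ?T" "u < n" "v < n" using fin[of i] fin[of j] e ij by auto
      moreover have "u \<noteq> v" using same e ij by blast
      ultimately show "\<not> h e" by (auto simp: adj_def e mix_def min_def max_def split: if_splits)
    qed
    then have "pr {h. mix ?T g h \<in> ?E} \<le> pr {h. \<forall>e\<in>f ` D. \<not> h e}"
      by (intro measure_pmf.finite_measure_mono) auto
    also have "\<dots> = (1 - p) ^ card (f ` D)" by (rule gnp_prob_no_edges[OF J p_nonneg p_le_1])
    also have "\<dots> \<le> exp (- p) ^ card (f ` D)"
      using p_le_1 exp_ge_add_one_self[of "- p"] by (intro power_mono) auto
    also have "\<dots> = exp (- (p * card (f ` D)))" by (simp add: exp_of_nat_mult[symmetric] mult.commute)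
    also have "\<dots> \<le> exp (- (p * a\<^sup>2 * N))"
      using mult_left_mono[OF cJ p_nonneg] by (simp add: mult.assoc)
    finally show ?thesis .
  qed
next
  fix g h assume "\<And>u v. u \<in> fst (sweep n g x k s) \<Longrightarrow> adj n g u v = adj n h u v"
  then show "fst (sweep n h x k s) = fst (sweep n g x k s)" using sweep_determined[of n g x k s h] by simp
qed

text \<open>Since \<open>dec\<close> is fixed, a label list \<open>ls\<close> alone determines the
  set \<open>R ls\<close> of pairs declared far, so the bound on crossing edges applies to each
  \<open>ls\<close> separately. For the labels of a correct labeling, the members of
  \<open>R ls\<close> with large layers are exactly the good pairs, and a crossing edge would
  contradict a declared distance.\<close>

lemma prob_short_labels:
  fixes a :: real and m :: nat
  assumes a: "0 \<le> a"
  shows "pr {g. \<exists>lab. is_distance_labeling n (adj n g) dec lab \<and> (\<Sum>i<s. length (lab (x i))) \<le> m}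
    \<le> pr {g. card (good_pairs a g) < (real s)\<^sup>2 / 4} + 4 ^ m * 2 ^ s * exp (- (p * a\<^sup>2 * ((real s)\<^sup>2 / 4)))"
proof -
  define Ls where "Ls = {ls :: bool list list. length ls = s \<and> sum_list (map length ls) \<le> m}"
  define R where "R ls = {(i, j) \<in> vertex_pairs s. \<not> dec (ls ! i) (ls ! j) \<le> enat (2 * k + 1)}" for ls
  define E where "E ls = {g. (real s)\<^sup>2 / 4 \<le> card {(i, j) \<in> R ls. a \<le> card (layer (st g i k)) \<and> a \<le> card (layer (st g j k))}
      \<and> (\<forall>(i, j)\<in>R ls. \<forall>u\<in>layer (st g i k). \<forall>v\<in>layer (st g j k). \<not> adj n g u v)}" for ls
  have Ls: "finite Ls" "card Ls \<le> 4 ^ m * 2 ^ s" using card_label_lists[of s m] by (auto simp: Ls_def)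
  have "{g. \<exists>lab. is_distance_labeling n (adj n g) dec lab \<and> (\<Sum>i<s. length (lab (x i))) \<le> m}
      \<subseteq> {g. card (good_pairs a g) < (real s)\<^sup>2 / 4} \<union> (\<Union>ls\<in>Ls. E ls)"
  proof (rule subsetI, unfold mem_Collect_eq, elim exE conjE)
    fix g lab
    assume lab: "is_distance_labeling n (adj n g) dec lab" and len: "(\<Sum>i<s. length (lab (x i))) \<le> m"
    define ls where "ls = map (\<lambda>i. lab (x i)) [0..<s]"
    have "ls \<in> Ls"
      using len by (simp add: Ls_def ls_def comp_def sum_list_sum_nth atLeast0LessThan)
    have dec: "dec (ls ! i) (ls ! j) = gdist (adj n g) (x i) (x j)" if "i < s" "j < s" for i j
      using lab that x_less by (simp add: ls_def is_distance_labeling_def)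
    have R: "R ls = {(i, j) \<in> vertex_pairs s. \<not> gdist (adj n g) (x i) (x j) \<le> enat (2 * k + 1)}"
      by (auto simp: R_def dec vertex_pairs_def)
    have "{(i, j) \<in> R ls. a \<le> card (layer (st g i k)) \<and> a \<le> card (layer (st g j k))} = good_pairs a g"
      by (auto simp: R good_pairs_def)
    moreover have "\<not> adj n g u v" if "(i, j) \<in> R ls" "u \<in> layer (st g i k)" "v \<in> layer (st g j k)" for i j u v
      using that gdist_le_if_outer_edge[of u n g x k i v j] by (auto simp: R)
    ultimately have "g \<in> E ls" if "\<not> card (good_pairs a g) < (real s)\<^sup>2 / 4"
      using that by (auto simp: E_def)
    with \<open>ls \<in> Ls\<close> show "g \<in> {g. card (good_pairs a g) < (real s)\<^sup>2 / 4} \<union> (\<Union>ls\<in>Ls. E ls)" by auto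
  qed
  then have "pr {g. \<exists>lab. is_distance_labeling n (adj n g) dec lab \<and> (\<Sum>i<s. length (lab (x i))) \<le> m}
      \<le> pr ({g. card (good_pairs a g) < (real s)\<^sup>2 / 4} \<union> (\<Union>ls\<in>Ls. E ls))"
    by (intro measure_pmf.finite_measure_mono) auto
  also have "\<dots> \<le> pr {g. card (good_pairs a g) < (real s)\<^sup>2 / 4} + pr (\<Union>ls\<in>Ls. E ls)"
    by (rule measure_subadditive) (auto simp: measure_pmf.emeasure_eq_measure)
  also have "pr (\<Union>ls\<in>Ls. E ls) \<le> (\<Sum>ls\<in>Ls. pr (E ls))"
    using Ls by (intro measure_pmf.finite_measure_subadditive_finite) auto
  also have "\<dots> \<le> (\<Sum>ls\<in>Ls. exp (- (p * a\<^sup>2 * ((real s)\<^sup>2 / 4))))"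
    unfolding E_def using a by (intro sum_mono prob_no_crossing_edges) (auto simp: R_def)
  also have "\<dots> = real (card Ls) * exp (- (p * a\<^sup>2 * ((real s)\<^sup>2 / 4)))" by simp
  also have "\<dots> \<le> real (4 ^ m * 2 ^ s) * exp (- (p * a\<^sup>2 * ((real s)\<^sup>2 / 4)))"
    using Ls by (intro mult_right_mono) (auto simp del: of_nat_mult)
  finally show ?thesis by simp
qed

end

section \<open>Averaging over blocks of vertices\<close>

text \<open>Markov's inequality for the number of short blocks needs no independence between blocks
  and costs only a factor 2, where a union bound would cost the number of blocks. Each block may
  have its own witness labeling, so the events concern one block at a time.\<close>

lemma prob_short_labeling_le_blocks:
  fixes n s m :: nat and M \<eta> p :: real
  defines "\<beta> \<equiv> n div s"
  assumes block: "\<And>b. b < \<beta> \<Longrightarrow> measure_pmf.prob (gnp n p) {g. \<exists>lab. is_distance_labeling n (adj n g) dec lab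
      \<and> (\<Sum>i<s. length (lab (b * s + i))) \<le> m} \<le> \<eta>"
    and \<beta>: "0 < \<beta>" and M: "2 * M \<le> real m * \<beta>"
  shows "measure_pmf.prob (gnp n p) {g. \<exists>lab. is_distance_labeling n (adj n g) dec lab
      \<and> real (labeling_length n lab) < M} \<le> 2 * \<eta>"
proof -
  define S where "S b g \<longleftrightarrow> (\<exists>lab. is_distance_labeling n (adj n g) dec lab
      \<and> (\<Sum>i<s. length (lab (b * s + i))) \<le> m)" for b g
  have "{g. \<exists>lab. is_distance_labeling n (adj n g) dec lab \<and> real (labeling_length n lab) < M}
      \<subseteq> {g. \<beta> / 2 \<le> real (card {b\<in>{..<\<beta>}. S b g})}"
  proof (rule subsetI, unfold mem_Collect_eq, elim exE conjE)
    fix g lab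
    assume lab: "is_distance_labeling n (adj n g) dec lab" and len: "real (labeling_length n lab) < M"
    define w where "w b = (\<Sum>i<s. length (lab (b * s + i)))" for b
    define C where "C = {b\<in>{..<\<beta>}. w b \<le> m}"
    have "w b = (\<Sum>v\<in>{b * s..<b * s + s}. length (lab v))" for b
      unfolding w_def using sum.shift_bounds_nat_ivl[of "\<lambda>v. length (lab v)" 0 "b * s" s]
      by (simp add: atLeast0LessThan add.commute)
    then have "(\<Sum>b<\<beta>. w b) = (\<Sum>v<\<beta> * s. length (lab v))"
      using sum.nat_group[of "\<lambda>v. length (lab v)" s \<beta>] by simp
    also have "\<dots> \<le> labeling_length n lab"
      unfolding labeling_length_def \<beta>_def by (intro sum_mono2) auto
    finally have "real (\<Sum>b<\<beta>. w b) < M" using len by linarith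
    moreover have "real (\<Sum>b\<in>{..<\<beta>} - C. m) \<le> real (\<Sum>b<\<beta>. w b)"
      unfolding of_nat_le_iff by (intro order.trans[OF sum_mono sum_mono2[where A = "{..<\<beta>} - C"]]) (auto simp: C_def)
    moreover have "C \<subseteq> {..<\<beta>}" by (auto simp: C_def)
    then have "card ({..<\<beta>} - C) = \<beta> - card C" "card C \<le> \<beta>"
      using card_Diff_subset[of C "{..<\<beta>}"] card_mono[of "{..<\<beta>}" C] finite_subset[of C "{..<\<beta>}"] by simp_all
    ultimately have "real m * (\<beta> - real (card C)) < M" by (simp add: of_nat_diff mult.commute)
    with M have "real m * (\<beta> - real (card C)) * 2 < real m * \<beta>" by linarith
    then have "real m * (\<beta> - 2 * real (card C)) < 0" by (simp add: algebra_simps)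
    then have "\<beta> / 2 \<le> real (card C)" by (simp add: mult_less_0_iff)
    also have "card C \<le> card {b\<in>{..<\<beta>}. S b g}"
      using lab by (intro card_mono) (auto simp: C_def S_def w_def)
    finally show "\<beta> / 2 \<le> real (card {b\<in>{..<\<beta>}. S b g})" by simp
  qed
  then have "measure_pmf.prob (gnp n p) {g. \<exists>lab. is_distance_labeling n (adj n g) dec lab \<and> real (labeling_length n lab) < M}
      \<le> measure_pmf.prob (gnp n p) {g. \<beta> / 2 \<le> real (card {b\<in>{..<\<beta>}. S b g})}"
    by (intro measure_pmf.finite_measure_mono) auto
  also have "\<dots> \<le> measure_pmf.expectation (gnp n p) (\<lambda>g. real (card {b\<in>{..<\<beta>}. S b g})) / (\<beta> / 2)"
    using \<beta> by (intro gnp_markov) auto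
  also have "measure_pmf.expectation (gnp n p) (\<lambda>g. real (card {b\<in>{..<\<beta>}. S b g}))
      = (\<Sum>b<\<beta>. measure_pmf.prob (gnp n p) {g. S b g})"
    by (rule expectation_card) simp
  also have "\<dots> / (\<beta> / 2) \<le> (\<Sum>b<\<beta>. \<eta>) / (\<beta> / 2)"
    unfolding S_def by (intro divide_right_mono sum_mono block) auto
  also have "\<dots> = 2 * \<eta>" using \<beta> by simp
  finally show ?thesis .
qed

lemma prob_short_labeling_le:
  fixes n k s m :: nat and p \<delta> M :: real
  assumes p: "p \<le> 1" and \<delta>: "0 < \<delta>" "\<delta> < 1" "1/2 \<le> (1 - \<delta>) ^ (2 * k)"
    and np: "8 \<le> n * p" "p * (n * p) ^ k \<le> \<delta>" and s: "8 \<le> s" "s \<le> n"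
    and M: "2 * M \<le> real m * real (n div s)"
  shows "measure_pmf.prob (gnp n p) {g. \<exists>lab. is_distance_labeling n (adj n g) dec lab
      \<and> real (labeling_length n lab) < M}
    \<le> 2 * (16 * (2 * s * (n * p) ^ k / (\<delta> * n) + s * p * (n * p) ^ k + 128 / (n * p))
        + 16 * (2 * p * ((n * p) ^ k)\<^sup>2)
        + exp (2 * m + s - p * ((n * p) ^ k / 4)\<^sup>2 * ((real s)\<^sup>2 / 4)))"
proof (rule prob_short_labeling_le_blocks[OF _ _ M])
  show "0 < n div s" using s by (simp add: div_greater_zero_iff)
  fix b assume b: "b < n div s"
  have "0 < n * p" using np by linarith
  then have p0: "0 \<le> p" by (auto simp: zero_less_mult_iff)
  interpret random_sweep n p "\<lambda>i. b * s + i" k s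
  proof
    fix i assume "i < s"
    then have "b * s + i < Suc b * s" by simp
    also have "\<dots> \<le> n div s * s" using b by (intro mult_le_mono1) simp
    also have "\<dots> \<le> n" by simp
    finally show "b * s + i < n" .
  qed (use p p0 in \<open>auto simp: inj_on_def\<close>)
  define a where "a = (n * p) ^ k / 4"
  have a: "0 \<le> a" using np by (simp add: a_def)
  have "pr {g. card (good_pairs a g) < (real s)\<^sup>2 / 4}
      \<le> 16 * (2 * s * (n * p) ^ k / (\<delta> * n) + s * p * (n * p) ^ k + 128 / (n * p))
        + 16 * (2 * p * ((n * p) ^ k)\<^sup>2)"
  proof (rule prob_few_good_pairs)
    show "pr {g. card (layer (st g i k)) < a}
        \<le> 2 * s * (n * p) ^ k / (\<delta> * n) + s * p * (n * p) ^ k + 128 / (n * p)" if "i < s" for i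
      unfolding a_def by (rule prob_small_layer[OF that \<delta> np])
    fix i j assume ij: "i < j" "j < s"
    have "pr {g. gdist (adj n g) (b * s + i) (b * s + j) \<le> enat (2 * k + 1)}
        \<le> (\<Sum>t<2 * k + 1. p * (n * p) ^ t)"
      using ij x_less[of i] by (intro prob_gdist_le p0 p) auto
    also have "\<dots> = p * (\<Sum>t\<le>2 * k. (n * p) ^ t)" by (simp only: sum_distrib_left lessThan_Suc_atMost Suc_eq_plus1[symmetric])
    also have "\<dots> \<le> p * (2 * (n * p) ^ (2 * k))"
      using np by (intro mult_left_mono sum_powers_le p0) auto
    also have "\<dots> = 2 * p * ((n * p) ^ k)\<^sup>2" by (simp add: power_mult[symmetric] mult.commute)
    finally show "pr {g. gdist (adj n g) (b * s + i) (b * s + j) \<le> enat (2 * k + 1)} \<le> 2 * p * ((n * p) ^ k)\<^sup>2" .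
  qed (use s in auto)
  moreover have "4 ^ m * 2 ^ s * exp (- (p * a\<^sup>2 * ((real s)\<^sup>2 / 4)))
      \<le> exp (2 * m + s - p * a\<^sup>2 * ((real s)\<^sup>2 / 4))"
  proof -
    have e2: "(2 :: real) \<le> exp 1" using exp_ge_add_one_self[of 1] by simp
    have "(4 :: real) ^ m = 2 ^ (2 * m)" by (simp add: power_mult)
    then have "(4 :: real) ^ m * 2 ^ s = 2 ^ (2 * m + s)" by (simp add: power_add)
    also have "\<dots> \<le> exp 1 ^ (2 * m + s)" using e2 by (intro power_mono) auto
    also have "\<dots> = exp (2 * m + s)" by (simp flip: exp_of_nat_mult)
    finally have "4 ^ m * 2 ^ s * exp (- (p * a\<^sup>2 * ((real s)\<^sup>2 / 4)))
        \<le> exp (real (2 * m + s)) * exp (- (p * a\<^sup>2 * ((real s)\<^sup>2 / 4)))"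
      by (intro mult_right_mono) auto
    then show ?thesis by (simp add: mult_exp_exp)
  qed
  ultimately show "pr {g. \<exists>lab. is_distance_labeling n (adj n g) dec lab \<and> (\<Sum>i<s. length (lab (b * s + i))) \<le> m}
     \<le> 16 * (2 * s * (n * p) ^ k / (\<delta> * n) + s * p * (n * p) ^ k + 128 / (n * p))
        + 16 * (2 * p * ((n * p) ^ k)\<^sup>2)
        + exp (2 * m + s - p * ((n * p) ^ k / 4)\<^sup>2 * ((real s)\<^sup>2 / 4))"
    using prob_short_labels[OF a, of dec m] unfolding a_def by linarith
qed

section \<open>Asymptotics\<close>

text \<open>With \<open>q\<close> the eighth root of \<open>ln n\<close> and
  \<open>r = \<surd>n\<close>, all quantities become monomials with integer exponents. For the cap
  \<open>z\<close> on the layers and the block size \<open>w\<close>, the errors are governed by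
  \<open>w z / (\<delta> n) = 1 / q\<close>, \<open>p w z = 2 / q\<close> and
  \<open>p z^2 = 2 / q^4\<close>, which all vanish as \<open>q\<close> grows.\<close>

lemma prob_short_labeling_explicit:
  fixes n :: nat and q r p :: real
  assumes q: "0 < q" and r: "0 < r" and n: "real n = r\<^sup>2" and p: "p = 2 * q ^ 8 / r\<^sup>2"
    and c1: "16 \<le> q ^ 8" and c2: "2 * q ^ 8 \<le> r\<^sup>2"
    and c3: "ln (r / q ^ 6) / ln (2 * q ^ 8) \<le> q ^ 8 / 4" and c4: "1 \<le> r / q ^ 6"
    and c5: "2 * q ^ 8 / r\<^sup>2 * (r / q ^ 6) \<le> 1 / q ^ 8" and c6: "16 \<le> r / q ^ 3"
    and c7: "r / q ^ 3 \<le> r\<^sup>2 / 2" and c8: "2 \<le> r / q ^ 23 / 256 - 8 * r / q ^ 24"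
  shows "measure_pmf.prob (gnp n p) {g. \<exists>lab. is_distance_labeling n (adj n g) dec lab
      \<and> real (labeling_length n lab) < r ^ 3 / q ^ 24}
    \<le> 2 * (16 * (2 / q + 2 / q + 64 / q ^ 8) + 16 * (4 / q ^ 4) + exp (2 - r / q ^ 3 / 2))"
proof -
  define \<Lambda> where "\<Lambda> = 2 * q ^ 8"
  define z where "z = r / q ^ 6"
  define w where "w = r / q ^ 3"
  define k where "k = nat \<lfloor>ln z / ln \<Lambda>\<rfloor>"
  define s where "s = nat \<lfloor>w\<rfloor>"
  \<comment> \<open>The bit budget of one block: there are at least \<open>n / (2 s)\<close> blocks,
    and the product is twice the target \<open>r ^ 3 / q ^ 24\<close>.\<close>
  define m where "m = nat \<lceil>4 * r * s / q ^ 24\<rceil>"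
  define D where "D = \<Lambda> ^ k"
  define \<delta> where "\<delta> = 1 / q ^ 8"
  have np: "n * p = \<Lambda>" using r by (simp add: n p \<Lambda>_def)
  have \<Lambda>: "32 \<le> \<Lambda>" using c1 by (simp add: \<Lambda>_def)
  have ln\<Lambda>: "0 < ln \<Lambda>" using \<Lambda> by (intro ln_gt_zero) simp
  have z: "1 \<le> z" using c4 by (simp add: z_def)
  have k: "k \<le> ln z / ln \<Lambda>" "ln z / ln \<Lambda> < k + 1"
    using z ln\<Lambda> unfolding k_def by (auto simp: of_nat_nat) linarith+
  have D_pos: "0 < D" using \<Lambda> by (simp add: D_def)
  have lnD: "ln D = k * ln \<Lambda>" unfolding D_def using \<Lambda> by (subst ln_realpow) auto
  have "ln D \<le> ln z" using k(1) ln\<Lambda> by (simp add: lnD field_simps)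
  then have D_le: "D \<le> z" using D_pos z by simp
  have "ln z \<le> ln D + ln \<Lambda>" using k(2) ln\<Lambda> by (simp add: lnD field_simps)
  also have "\<dots> = ln (D * \<Lambda>)" using D_pos \<Lambda> by (simp add: ln_mult)
  finally have "z \<le> D * \<Lambda>" using D_pos \<Lambda> z by simp
  \<comment> \<open>Rounding \<open>k\<close> down may cost a whole factor \<open>\<Lambda>\<close>.
    It enters the exponent squared, which accounts for two of the three logarithms in the
    bound.\<close>
  then have D_ge: "z / \<Lambda> \<le> D" using \<Lambda> by (simp add: divide_le_eq)
  have w: "16 \<le> w" "w \<le> r\<^sup>2 / 2" using c6 c7 by (auto simp: w_def)
  have s: "s \<le> w" "w < s + 1" unfolding s_def using w by linarith+
  have s': "w / 2 \<le> s" "8 \<le> real s" "0 < real s" "2 * real s \<le> n" using s w by (auto simp: n)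
  have m: "4 * r * s / q ^ 24 \<le> m" "m \<le> 4 * r * s / q ^ 24 + 1"
  proof -
    have "0 \<le> 4 * r * s / q ^ 24" using q r by simp
    then show "4 * r * s / q ^ 24 \<le> m" "m \<le> 4 * r * s / q ^ 24 + 1"
      unfolding m_def by linarith+
  qed
  have p01: "0 < p" "p \<le> 1" using q r c2 by (auto simp: p)
  have \<delta>: "0 < \<delta>" "\<delta> \<le> 1 / 16" using q c1 by (auto simp: \<delta>_def divide_simps)
  have "measure_pmf.prob (gnp n p) {g. \<exists>lab. is_distance_labeling n (adj n g) dec lab
      \<and> real (labeling_length n lab) < r ^ 3 / q ^ 24}
    \<le> 2 * (16 * (2 * s * (n * p) ^ k / (\<delta> * n) + s * p * (n * p) ^ k + 128 / (n * p))
        + 16 * (2 * p * ((n * p) ^ k)\<^sup>2)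
        + exp (2 * m + s - p * ((n * p) ^ k / 4)\<^sup>2 * ((real s)\<^sup>2 / 4)))"
  proof (rule prob_short_labeling_le)
    \<comment> \<open>With \<open>\<delta> = 1 / q ^ 8\<close> the accumulated loss
      \<open>2 * k * \<delta>\<close> stays below \<open>1/2\<close>, so Bernoulli's inequality
      keeps half of the layer size.\<close>
    have "k \<le> q ^ 8 / 4" using k(1) c3 unfolding z_def \<Lambda>_def by (rule order.trans)
    then have "2 * k * \<delta> \<le> 1 / 2" using q by (simp add: \<delta>_def field_simps)
    then have "1 / 2 \<le> 1 + real (2 * k) * - \<delta>" by simp
    also have "\<dots> \<le> (1 + - \<delta>) ^ (2 * k)" using \<delta> by (intro Bernoulli_inequality) auto
    finally show "1 / 2 \<le> (1 - \<delta>) ^ (2 * k)" by simp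
    show "p * (n * p) ^ k \<le> \<delta>"
    proof -
      have "p * D \<le> p * z" using D_le p01 by (intro mult_left_mono) auto
      also have "\<dots> \<le> \<delta>" using c5 by (simp add: p z_def \<delta>_def)
      finally show ?thesis by (simp add: np D_def)
    qed
    show "2 * (r ^ 3 / q ^ 24) \<le> real m * real (n div s)"
    proof -
      have "n div s * s + n mod s = n" "n mod s < s" using s' by simp_all
      then have "n < Suc (n div s) * s" by (simp only: mult_Suc)
      then have "real n < real (Suc (n div s) * s)" by (simp only: of_nat_less_iff)
      then have "n / s - 1 \<le> n div s" using s' by (simp add: field_simps)
      moreover have "n / s / 2 \<le> n / s - 1" using s' by (simp add: field_simps)
      ultimately have div: "n / s / 2 \<le> n div s" by linarith
      have "2 * (r ^ 3 / q ^ 24) = 4 * r * s / q ^ 24 * (n / s / 2)"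
        using s' by (simp add: n power2_eq_square power3_eq_cube)
      also have "\<dots> \<le> m * real (n div s)" using m div q r s' by (intro mult_mono) auto
      finally show ?thesis .
    qed
  qed (use p01 \<delta> np \<Lambda> s' in auto)
  also have "2 * s * (n * p) ^ k / (\<delta> * n) \<le> 2 / q"
  proof -
    have "s * D \<le> w * z" using s D_le D_pos w by (intro mult_mono) auto
    then have "2 * (s * D) / (\<delta> * n) \<le> 2 * (w * z) / (\<delta> * n)"
      using \<delta> by (intro divide_right_mono) auto
    also have "\<dots> = 2 / q" using q r by (simp add: w_def z_def \<delta>_def n field_simps eval_nat_numeral)
    finally show ?thesis by (simp add: np D_def mult.assoc)
  qed
  also have "s * p * (n * p) ^ k \<le> 2 / q"
  proof -
    have "s * D \<le> w * z" using s D_le D_pos w by (intro mult_mono) auto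
    then have "p * (s * D) \<le> p * (w * z)" using p01 by (intro mult_left_mono) auto
    also have "\<dots> = 2 / q" using q r by (simp add: w_def z_def p field_simps eval_nat_numeral)
    finally show ?thesis unfolding np D_def[symmetric] by (simp only: mult_ac)
  qed
  also have "128 / (n * p) = 64 / q ^ 8" by (simp add: np \<Lambda>_def)
  also have "2 * p * ((n * p) ^ k)\<^sup>2 \<le> 4 / q ^ 4"
  proof -
    have "D\<^sup>2 \<le> z\<^sup>2" using D_le D_pos by (intro power_mono) auto
    then have "2 * p * D\<^sup>2 \<le> 2 * p * z\<^sup>2" using p01 by (intro mult_left_mono) auto
    also have "\<dots> = 4 / q ^ 4" using q r by (simp add: z_def p field_simps eval_nat_numeral)
    finally show ?thesis by (simp add: np D_def)
  qed
  also have "2 * m + s - p * ((n * p) ^ k / 4)\<^sup>2 * ((real s)\<^sup>2 / 4) \<le> 2 - r / q ^ 3 / 2"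
  proof -
    have "p * (z / \<Lambda> / 4)\<^sup>2 * (s * (w / 2) / 4) \<le> p * (D / 4)\<^sup>2 * ((real s)\<^sup>2 / 4)"
      unfolding power2_eq_square[of "real s"] using D_ge p01 s' z \<Lambda> w
      by (intro mult_mono divide_right_mono power_mono) auto
    also have "p * (z / \<Lambda> / 4)\<^sup>2 * (s * (w / 2) / 4) = s * (r / q ^ 23 / 256)"
      using q r by (simp add: z_def w_def \<Lambda>_def p field_simps eval_nat_numeral)
    finally have ent: "s * (r / q ^ 23 / 256) \<le> p * (D / 4)\<^sup>2 * ((real s)\<^sup>2 / 4)" .
    \<comment> \<open>After paying for the label bits, \<open>c8\<close> leaves \<open>2 * s\<close>
      in the exponent: one \<open>s\<close> cancels the factor \<open>2 ^ s\<close> of the label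
      count, the other gives the decay. The additive 2 in the result comes from rounding
      \<open>m\<close> up.\<close>
    have "real s * 2 \<le> s * (r / q ^ 23 / 256 - 8 * r / q ^ 24)" using c8 by (intro mult_left_mono) auto
    also have "\<dots> = s * (r / q ^ 23 / 256) - 2 * (4 * r * s / q ^ 24)" by (simp add: algebra_simps)
    finally have "2 * m + s - p * (D / 4)\<^sup>2 * ((real s)\<^sup>2 / 4) \<le> 2 - real s" using m(2) ent by linarith
    also have "\<dots> \<le> 2 - w / 2" using s' by simp
    finally show ?thesis by (simp add: np D_def w_def)
  qed
  finally show ?thesis by simp
qed

text \<open>The decoder may vary with \<open>n\<close>; the reduction from covers relies on this,
  since its code width grows with \<open>n\<close>.\<close>

lemma prob_short_labeling_tendsto_0:
  "(\<lambda>n. measure_pmf.prob (gnp n (2 * ln (real n) / real n))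
     {g. \<exists>lab. is_distance_labeling n (adj n g) (dec n) lab
       \<and> real (labeling_length n lab) < real n powr (3/2) / ln (real n) ^ 3}) \<longlonglongrightarrow> 0"
  (is "?f \<longlonglongrightarrow> 0")
proof (rule tendsto_sandwich)
  let ?q = "\<lambda>n :: nat. ln (real n) powr (1/8)" and ?r = "\<lambda>n :: nat. sqrt (real n)"
  show "\<forall>\<^sub>F n in sequentially. 0 \<le> ?f n" by simp
  show "(\<lambda>_. 0 :: real) \<longlonglongrightarrow> 0" by simp
  show "(\<lambda>n. 2 * (16 * (2 / ?q n + 2 / ?q n + 64 / ?q n ^ 8) + 16 * (4 / ?q n ^ 4)
      + exp (2 - ?r n / ?q n ^ 3 / 2))) \<longlonglongrightarrow> 0"
    by real_asymp
  have "\<forall>\<^sub>F n in sequentially. 16 \<le> ?q n ^ 8" by real_asymp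
  moreover have "\<forall>\<^sub>F n in sequentially. 2 * ?q n ^ 8 \<le> (?r n)\<^sup>2" by real_asymp
  moreover have "\<forall>\<^sub>F n in sequentially. ln (?r n / ?q n ^ 6) / ln (2 * ?q n ^ 8) \<le> ?q n ^ 8 / 4"
    by real_asymp
  moreover have "\<forall>\<^sub>F n in sequentially. 1 \<le> ?r n / ?q n ^ 6" by real_asymp
  moreover have "\<forall>\<^sub>F n in sequentially. 2 * ?q n ^ 8 / (?r n)\<^sup>2 * (?r n / ?q n ^ 6) \<le> 1 / ?q n ^ 8"
    by real_asymp
  moreover have "\<forall>\<^sub>F n in sequentially. 16 \<le> ?r n / ?q n ^ 3" by real_asymp
  moreover have "\<forall>\<^sub>F n in sequentially. ?r n / ?q n ^ 3 \<le> (?r n)\<^sup>2 / 2" by real_asymp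
  moreover have "\<forall>\<^sub>F n in sequentially. 2 \<le> ?r n / ?q n ^ 23 / 256 - 8 * ?r n / ?q n ^ 24"
    by real_asymp
  moreover have "\<forall>\<^sub>F n in sequentially. 2 \<le> n" by (rule eventually_ge_at_top)
  ultimately show "\<forall>\<^sub>F n in sequentially. ?f n \<le> 2 * (16 * (2 / ?q n + 2 / ?q n + 64 / ?q n ^ 8)
      + 16 * (4 / ?q n ^ 4) + exp (2 - ?r n / ?q n ^ 3 / 2))"
  proof eventually_elim
    case (elim n)
    have "1 < real n" using elim by simp
    then have l: "0 < ln (real n)" by simp
    have q8: "?q n ^ 8 = ln (real n)" using l by (simp add: powr_powr flip: powr_realpow)
    have q24: "?q n ^ 24 = ln (real n) ^ 3" using power_mult[of "?q n" 8 3] unfolding q8 by simp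
    have "real n powr (3/2) = (real n powr (1/2)) powr 3" by (simp add: powr_powr)
    then have r3: "?r n ^ 3 = real n powr (3/2)" using elim by (simp add: powr_half_sqrt powr_numeral)
    have "measure_pmf.prob (gnp n (2 * ln (real n) / real n))
       {g. \<exists>lab. is_distance_labeling n (adj n g) (dec n) lab
         \<and> real (labeling_length n lab) < ?r n ^ 3 / ?q n ^ 24}
      \<le> 2 * (16 * (2 / ?q n + 2 / ?q n + 64 / ?q n ^ 8) + 16 * (4 / ?q n ^ 4)
        + exp (2 - ?r n / ?q n ^ 3 / 2))"
      using elim l by (intro prob_short_labeling_explicit) (auto simp: q8)
    then show ?case unfolding r3 q24 .
  qed
qed

section \<open>2-hop covers as labelings\<close>

lemma has_walk_split: "has_walk E (a + b) u v \<Longrightarrow> \<exists>w. has_walk E a u w \<and> has_walk E b w v"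
proof (induction a arbitrary: u)
  case (Suc a)
  then obtain u' where u': "E u u'" "has_walk E (a + b) u' v" by auto
  from Suc.IH[OF u'(2)] obtain w where "has_walk E a u' w" "has_walk E b w v" by blast
  with u'(1) show ?case by (intro exI[of _ w]) auto
qed auto

lemma gdist_eq_enatD:
  assumes "gdist E u v = enat d"
  shows "has_walk E d u v" and "has_walk E j u v \<Longrightarrow> d \<le> j"
proof -
  have d: "d = (LEAST k. has_walk E k u v)" and ex: "\<exists>k. has_walk E k u v"
    using assms by (auto simp: gdist_def split: if_splits)
  show "has_walk E d u v" unfolding d using ex by (rule LeastI_ex)
  show "d \<le> j" if "has_walk E j u v" unfolding d using that by (rule Least_le)
qed

lemma has_walk_vertex_less: "has_walk (adj n g) j u v \<Longrightarrow> u < n \<Longrightarrow> v < n"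
  by (induction j arbitrary: u) (auto simp: adj_def)

text \<open>The vertices of a shortest walk have pairwise different distances from its start.\<close>
lemma gdist_less:
  assumes "gdist (adj n g) u v = enat d" "u < n"
  shows "d < n"
proof -
  have "\<exists>w. has_walk (adj n g) t u w \<and> has_walk (adj n g) (d - t) w v" if "t \<le> d" for t
    using has_walk_split[of "adj n g" t "d - t" u v] gdist_eq_enatD(1)[OF assms(1)] that by simp
  then obtain w where w: "has_walk (adj n g) t u (w t)" "has_walk (adj n g) (d - t) (w t) v" if "t \<le> d" for t
    by metis
  have le: "t \<le> t'" if "t \<le> d" "t' \<le> d" "w t = w t'" for t t'
  proof -
    have "has_walk (adj n g) (t' + (d - t)) u v"
      using has_walk_append[OF w(1)[of t'] w(2)[of t, unfolded that(3)]] that by simp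
    then have "d \<le> t' + (d - t)" by (rule gdist_eq_enatD(2)[OF assms(1)])
    with that show ?thesis by linarith
  qed
  have "inj_on w {..d}"
  proof (rule inj_onI)
    fix t t' assume "t \<in> {..d}" "t' \<in> {..d}" "w t = w t'"
    then show "t = t'" using le[of t t'] le[of t' t] by simp
  qed
  moreover have "w ` {..d} \<subseteq> {..<n}" using w(1) assms(2) has_walk_vertex_less by blast
  ultimately have "card {..d} \<le> card {..<n}" by (intro card_inj_on_le) auto
  then show ?thesis by simp
qed

lemma gdist_sym: "gdist (adj n g) u v = gdist (adj n g) v u"
proof -
  have "has_walk (adj n g) k u v \<longleftrightarrow> has_walk (adj n g) k v u" for k
    using has_walk_adj_rev by blast
  then show ?thesis by (simp add: gdist_def)
qed

lemma gdist_triangle: "gdist E u w \<le> gdist E u v + gdist E v w"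
proof (cases "gdist E u v"; cases "gdist E v w")
  fix a b assume "gdist E u v = enat a" "gdist E v w = enat b"
  moreover from this have "has_walk E (a + b) u w"
    by (intro has_walk_append gdist_eq_enatD(1))
  ultimately show ?thesis using gdist_le_iff[of E u w "a + b"] by auto
qed auto

text \<open>The cover condition speaks only of connected pairs. For all others the triangle
  inequality makes every sum infinite, and an empty infimum is \<open>\<infinity>\<close> as well,
  so a labeling built from a cover is exact everywhere.\<close>

lemma is_2hop_cover_gdist:
  assumes "is_2hop_cover n (adj n g) L" "u < n" "v < n"
  shows "(INF z\<in>L u \<inter> L v. gdist (adj n g) u z + gdist (adj n g) z v) = gdist (adj n g) u v"
proof (cases "gdist (adj n g) u v = \<infinity>")
  case True
  then have "gdist (adj n g) u z + gdist (adj n g) z v = \<infinity>" for z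
    using gdist_triangle[of "adj n g" u v z] by simp
  then show ?thesis using True by (simp add: top_enat_def[symmetric])
qed (use assms in \<open>auto simp: is_2hop_cover_def\<close>)

text \<open>There are at most \<open>(2 ^ B) ^ j\<close> subsets of size \<open>j\<close>, so they
  embed into the words of length \<open>B * j\<close>. As \<open>B > 0\<close>, the length reveals
  the size, and the embeddings combine into one injective code without delimiters.\<close>

lemma ex_subset_code:
  fixes X :: "'a set"
  assumes X: "finite X" "card X \<le> 2 ^ B" and B: "0 < B"
  obtains \<phi> :: "'a set \<Rightarrow> bool list"
    where "inj_on \<phi> (Pow X)" "\<And>E. E \<subseteq> X \<Longrightarrow> length (\<phi> E) = B * card E"
proof -
  have "\<exists>f. f ` {E. E \<subseteq> X \<and> card E = j} \<subseteq> {w :: bool list. length w = B * j} \<and> inj_on f {E. E \<subseteq> X \<and> card E = j}" for j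
  proof (rule card_le_inj)
    show "finite {E. E \<subseteq> X \<and> card E = j}" using X by simp
    show "finite {w :: bool list. length w = B * j}"
      using finite_lists_length_eq[of "UNIV :: bool set"] by simp
    have "card {E. E \<subseteq> X \<and> card E = j} = card X choose j" by (rule n_subsets[OF X(1)])
    also have "\<dots> \<le> card X ^ j"
      by (cases "j \<le> card X") (auto simp: binomial_eq_0 intro: binomial_le_pow)
    also have "\<dots> \<le> (2 ^ B) ^ j" using X by (intro power_mono) auto
    also have "\<dots> = card {w :: bool list. length w = B * j}"
      using card_lists_length_eq[of "UNIV :: bool set" "B * j"] by (simp add: power_mult)
    finally show "card {E. E \<subseteq> X \<and> card E = j} \<le> card {w :: bool list. length w = B * j}" .
  qed
  then have "\<exists>f. \<forall>j. f j ` {E. E \<subseteq> X \<and> card E = j} \<subseteq> {w :: bool list. length w = B * j}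
      \<and> inj_on (f j) {E. E \<subseteq> X \<and> card E = j}"
    by (intro choice allI)
  then obtain f where f: "f j ` {E. E \<subseteq> X \<and> card E = j} \<subseteq> {w :: bool list. length w = B * j}"
    "inj_on (f j) {E. E \<subseteq> X \<and> card E = j}" for j
    by blast
  have len: "length (f (card E) E) = B * card E" if "E \<subseteq> X" for E
    using f(1)[of "card E"] that by auto
  show thesis
  proof (rule that[of "\<lambda>E. f (card E) E"])
    show "inj_on (\<lambda>E. f (card E) E) (Pow X)"
    proof (rule inj_onI)
      fix E E' assume E: "E \<in> Pow X" "E' \<in> Pow X" "f (card E) E = f (card E') E'"
      then have "B * card E = B * card E'" by (metis PowD len)
      then have "card E = card E'" using B by simp
      then show "E = E'" using E inj_onD[OF f(2)[of "card E"], of E E'] by simp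
    qed
  qed (rule len)
qed

lemma ex_decoder_for_2hop_covers:
  assumes B: "n * (n + 1) \<le> 2 ^ B" "0 < B"
  shows "\<exists>dec. \<forall>g L. is_2hop_cover n (adj n g) L \<longrightarrow>
    (\<exists>lab. is_distance_labeling n (adj n g) dec lab \<and> labeling_length n lab = B * num_landmarks n L)"
proof -
  define X where "X = {..<n} \<times> insert \<infinity> (enat ` {..<n})"
  have "card (enat ` {..<n}) = n" by (subst card_image) (auto simp: inj_on_def)
  then have "card (insert \<infinity> (enat ` {..<n})) = n + 1" by (simp add: card_insert_if image_iff)
  then have "finite X" "card X \<le> 2 ^ B" using B(1) by (auto simp: X_def card_cartesian_product)
  then obtain \<phi> :: "(nat \<times> enat) set \<Rightarrow> bool list" where \<phi>: "inj_on \<phi> (Pow X)"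
      "\<And>E. E \<subseteq> X \<Longrightarrow> length (\<phi> E) = B * card E"
    using ex_subset_code[OF _ _ B(2), of X] by blast
  define \<psi> where "\<psi> = the_inv_into (Pow X) \<phi>"
  define dec where "dec a b = (INF (e, f)\<in>{(e, f). e \<in> \<psi> a \<and> f \<in> \<psi> b \<and> fst e = fst f}. snd e + snd f)" for a b
  show ?thesis
  proof (intro exI[of _ dec] allI impI)
    fix g L assume cover: "is_2hop_cover n (adj n g) L"
    define S where "S v = (\<lambda>z. (z, gdist (adj n g) v z)) ` L v" for v
    have S: "S v \<subseteq> X" if "v < n" for v
    proof -
      have "gdist (adj n g) v z \<in> insert \<infinity> (enat ` {..<n})" for z
        using gdist_less[OF _ that, of g z] by (cases "gdist (adj n g) v z") auto
      moreover have "L v \<subseteq> {..<n}" using cover that by (simp add: is_2hop_cover_def)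
      ultimately show ?thesis by (auto simp: S_def X_def)
    qed
    have \<psi>: "\<psi> (\<phi> (S v)) = S v" if "v < n" for v
      unfolding \<psi>_def using S[OF that] by (intro the_inv_into_f_f[OF \<phi>(1)]) simp
    have "dec (\<phi> (S u)) (\<phi> (S v)) = gdist (adj n g) u v" if "u < n" "v < n" for u v
    proof -
      have "{(e, f). e \<in> S u \<and> f \<in> S v \<and> fst e = fst f}
          = (\<lambda>z. ((z, gdist (adj n g) u z), (z, gdist (adj n g) v z))) ` (L u \<inter> L v)"
        by (auto simp: S_def image_iff)
      then have "dec (\<phi> (S u)) (\<phi> (S v)) = (INF z\<in>L u \<inter> L v. gdist (adj n g) u z + gdist (adj n g) z v)"
        unfolding dec_def by (simp add: \<psi> that image_image gdist_sym[of n g v])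
      then show ?thesis using is_2hop_cover_gdist[OF cover that] by simp
    qed
    then have "is_distance_labeling n (adj n g) dec (\<lambda>v. \<phi> (S v))"
      by (simp add: is_distance_labeling_def)
    moreover have "card (S v) = card (L v)" for v
      unfolding S_def by (intro card_image inj_onI) auto
    then have "labeling_length n (\<lambda>v. \<phi> (S v)) = B * num_landmarks n L"
      using \<phi>(2) S by (simp add: labeling_length_def num_landmarks_def sum_distrib_left)
    ultimately show "\<exists>lab. is_distance_labeling n (adj n g) dec lab \<and> labeling_length n lab = B * num_landmarks n L"
      by blast
  qed
qed

theorem theorem6p1:
  shows "(\<exists>c>0. \<forall>dec :: nat \<Rightarrow> bool list \<Rightarrow> bool list \<Rightarrow> enat.
            (\<lambda>n. measure_pmf.prob (gnp n (2 * ln (real n) / real n))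
               {g. \<exists>lab. is_distance_labeling n (adj n g) (dec n) lab \<and>
                     real (labeling_length n lab) < c * real n powr (3/2) / ln (real n) ^ 4})
            \<longlonglongrightarrow> 0)
       \<and> (\<exists>c>0.
            (\<lambda>n. measure_pmf.prob (gnp n (2 * ln (real n) / real n))
               {g. \<exists>L. is_2hop_cover n (adj n g) L \<and>
                     real (num_landmarks n L) < c * real n powr (3/2) / ln (real n) ^ 4})
            \<longlonglongrightarrow> 0)"
proof (intro conjI exI[of _ "1/4 :: real"] allI)
  fix dec :: "nat \<Rightarrow> bool list \<Rightarrow> bool list \<Rightarrow> enat"
  show "(\<lambda>n. measure_pmf.prob (gnp n (2 * ln (real n) / real n))
      {g. \<exists>lab. is_distance_labeling n (adj n g) (dec n) lab \<and>
        real (labeling_length n lab) < 1/4 * real n powr (3/2) / ln (real n) ^ 4}) \<longlonglongrightarrow> 0"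
  proof (rule tendsto_sandwich[OF _ _ tendsto_const prob_short_labeling_tendsto_0[of dec]])
    have "\<forall>\<^sub>F n in sequentially. 1/4 * real n powr (3/2) / ln (real n) ^ 4 \<le> real n powr (3/2) / ln (real n) ^ 3"
      by real_asymp
    then show "\<forall>\<^sub>F n in sequentially. measure_pmf.prob (gnp n (2 * ln (real n) / real n))
        {g. \<exists>lab. is_distance_labeling n (adj n g) (dec n) lab \<and>
          real (labeling_length n lab) < 1/4 * real n powr (3/2) / ln (real n) ^ 4}
      \<le> measure_pmf.prob (gnp n (2 * ln (real n) / real n))
        {g. \<exists>lab. is_distance_labeling n (adj n g) (dec n) lab \<and>
          real (labeling_length n lab) < real n powr (3/2) / ln (real n) ^ 3}"
      by eventually_elim (intro measure_pmf.finite_measure_mono, auto)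
  qed auto
next
  \<comment> \<open>The factor 4 cancels against the constant \<open>1/4\<close> in the bound for
    covers, and one logarithm of \<open>ln (real n) ^ 4\<close> against the code width.\<close>
  define B where "B n = nat \<lfloor>4 * ln (real n)\<rfloor>" for n
  define D where "D n dec \<longleftrightarrow> (\<forall>g L. is_2hop_cover n (adj n g) L \<longrightarrow>
    (\<exists>lab. is_distance_labeling n (adj n g) dec lab \<and> labeling_length n lab = B n * num_landmarks n L))" for n dec
  \<comment> \<open>A suitable decoder is obtained only for large \<open>n\<close>; the arbitrary
    choice for the others does not affect the limit.\<close>
  define dec where "dec n = (SOME dec. D n dec)" for n
  show "(\<lambda>n. measure_pmf.prob (gnp n (2 * ln (real n) / real n))
      {g. \<exists>L. is_2hop_cover n (adj n g) L \<and>
        real (num_landmarks n L) < 1/4 * real n powr (3/2) / ln (real n) ^ 4}) \<longlonglongrightarrow> 0"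
  proof (rule tendsto_sandwich[OF _ _ tendsto_const prob_short_labeling_tendsto_0[of dec]])
    \<comment> \<open>This yields \<open>n * (n + 1) \<le> 2 ^ B n\<close>: \<open>2 / 3\<close> is
      a lower bound for \<open>ln 2\<close>, and the \<open>- 1\<close> allows for the floor in
      \<open>B n\<close>. The right side grows like \<open>n powr (8/3)\<close>.\<close>
    have "\<forall>\<^sub>F n in sequentially. real n * (real n + 1) \<le> exp ((4 * ln (real n) - 1) * (2 / 3))" by real_asymp
    moreover have "\<forall>\<^sub>F n in sequentially. 1 \<le> ln (real n)" by real_asymp
    ultimately show "\<forall>\<^sub>F n in sequentially. measure_pmf.prob (gnp n (2 * ln (real n) / real n))
        {g. \<exists>L. is_2hop_cover n (adj n g) L \<and>
          real (num_landmarks n L) < 1/4 * real n powr (3/2) / ln (real n) ^ 4}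
      \<le> measure_pmf.prob (gnp n (2 * ln (real n) / real n))
        {g. \<exists>lab. is_distance_labeling n (adj n g) (dec n) lab \<and>
          real (labeling_length n lab) < real n powr (3/2) / ln (real n) ^ 3}"
    proof eventually_elim
      case (elim n)
      have B: "B n \<le> 4 * ln (real n)" "4 * ln (real n) - 1 \<le> B n" "0 < B n"
        using elim(2) unfolding B_def by linarith+
      have "real (n * (n + 1)) \<le> exp ((4 * ln (real n) - 1) * (2 / 3))"
        using elim(1) by (simp only: of_nat_mult of_nat_add of_nat_1)
      also have "\<dots> \<le> exp ((4 * ln (real n) - 1) * ln 2)"
        using elim(2) ln2_ge_two_thirds unfolding exp_le_cancel_iff by (intro mult_left_mono) auto
      also have "\<dots> = 2 powr (4 * ln (real n) - 1)" by (simp add: powr_def)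
      also have "\<dots> \<le> 2 powr B n" using B by (intro powr_mono) auto
      also have "\<dots> = real (2 ^ B n)" by (simp add: powr_realpow)
      finally have "n * (n + 1) \<le> 2 ^ B n" by (simp only: of_nat_le_iff)
      then have "\<exists>dec. D n dec"
        unfolding D_def using B(3) by (rule ex_decoder_for_2hop_covers)
      then have "D n (dec n)" unfolding dec_def by (rule someI_ex)
      have "{g. \<exists>L. is_2hop_cover n (adj n g) L \<and> real (num_landmarks n L) < 1/4 * real n powr (3/2) / ln (real n) ^ 4}
          \<subseteq> {g. \<exists>lab. is_distance_labeling n (adj n g) (dec n) lab \<and>
            real (labeling_length n lab) < real n powr (3/2) / ln (real n) ^ 3}"
      proof (rule subsetI, unfold mem_Collect_eq, elim exE conjE)
        fix g L assume "is_2hop_cover n (adj n g) L"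
          and few: "real (num_landmarks n L) < 1/4 * real n powr (3/2) / ln (real n) ^ 4"
        with \<open>D n (dec n)\<close> obtain lab where lab: "is_distance_labeling n (adj n g) (dec n) lab"
            "labeling_length n lab = B n * num_landmarks n L"
          unfolding D_def by blast
        have "real (labeling_length n lab) \<le> 4 * ln (real n) * num_landmarks n L"
          unfolding lab(2) using B by (simp add: mult_right_mono)
        also have "\<dots> < 4 * ln (real n) * (1/4 * real n powr (3/2) / ln (real n) ^ 4)"
          using few elim(2) by (intro mult_strict_left_mono) auto
        also have "\<dots> = real n powr (3/2) / ln (real n) ^ 3"
          using elim(2) by (simp add: field_simps eval_nat_numeral)
        finally show "\<exists>lab. is_distance_labeling n (adj n g) (dec n) lab \<and>
            real (labeling_length n lab) < real n powr (3/2) / ln (real n) ^ 3"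
          using lab(1) by blast
      qed
      then show ?case by (intro measure_pmf.finite_measure_mono) auto
    qed
  qed auto
qed auto

end
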